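(* Let $R=K[x_1,\dots,x_n]$ be the standard graded polynomial ring over a field $K$, let $k\ge 1$, and let $I\subseteq(x_1,\dots,x_n)$ be a homogeneous Gorenstein ideal (i.e. $S=R/I$ is Gorenstein) of grade $s=2k$. Write the minimal graded free resolution of $S$ over $R$ as $$0\to R(-c)\to\bigoplus_{j=1}^{b_1}R(-(c-a_{1j}))\to\cdots\to\bigoplus_{j=1}^{r_k}R(-(c-a_{kj}))\oplus\bigoplus_{j=1}^{r_k}R(-a_{kj})\to\cdots\to\bigoplus_{j=1}^{b_1}R(-a_{1j})\to R ,$$ where $r_k=b_k/2$ and $b_k$ is the rank of the middle (homological degree $k$) module; put $r_i=b_i$ for $1\le i<k$. Then for every $l\ge0$ the $l$-th Hilbert coefficient $e_l$ of $S$ satisfies $$(-1)^k(s+l)!\,e_l=\sum_{r=0}^{l}\ \sum_{t=0}^{\lfloor r/2\rfloor}(-1)^{l-r+t}\,\nu_{l-r}\left[\binom{k+r-t}{k+t}+\binom{k+r-t-1}{k+t-1}\right]c^{\,r-2t}\sum_{i=1}^k\sum_{j=1}^{r_i}(-1)^i a_{ij}^{k+t}(c-a_{ij})^{k+t}.$$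
   Context: Hilbert coefficients: let $d=\dim S=n-s$. The Hilbert series of $S$ has the form $\sum_{i\ge0}\dim_K(S_i)t^i=Q(t)/(1-t)^d$ with $Q$ a polynomial, and $e_l=e_l(S)=Q^{(l)}(1)/l!$. For $0\le r\le l$, $$\nu_{l-r}=\sum_{1\le \xi_1<\xi_2<\cdots<\xi_{l-r}\le s+l-1}\xi_1\xi_2\cdots\xi_{l-r},\qquad \nu_0=1,$$ i.e. $\nu_{l-r}$ is the elementary symmetric polynomial of degree $l-r$ evaluated at $1,2,\dots,s+l-1$. Because $S$ is Gorenstein, its minimal resolution is self-dual; the rank $b_k$ of the middle module is even and the resolution can be written in the displayed symmetric form. Convention: $\binom{n}{p}=0$ if $n<p$, for nonnegative integers $n,p$. *)

theory Defs
  imports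
    "HOL-Algebra.Embedded_Algebras"
    "HOL-Algebra.Ring_Divisibility"
    "HOL-Algebra.Algebraic_Closure_Type"
    "HOL-Library.Poly_Mapping"
    "HOL-Library.Cardinality"
    "HOL-Library.Extended_Nat"
    "HOL-Computational_Algebra.Polynomial_FPS"
begin

section \<open>The standard graded polynomial ring\<close>

text \<open>The variables are indexed by a finite type \<open>'n\<close>, so that the number of variables
  is \<open>CARD('n)\<close>. A polynomial is a finitely supported function on the exponent vectors.\<close>

type_synonym ('n, 'k) mpoly = "('n \<Rightarrow>\<^sub>0 nat) \<Rightarrow>\<^sub>0 'k"

abbreviation mpoly_ring :: "('n::finite, 'k::field) mpoly ring"
  where "mpoly_ring \<equiv> ring_of_type_algebra"

definition mpoly_var :: "'n::finite \<Rightarrow> ('n, 'k::field) mpoly"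
  where "mpoly_var i = Poly_Mapping.single (Poly_Mapping.single i 1) 1"

definition mpoly_const :: "'k::field \<Rightarrow> ('n::finite, 'k) mpoly"
  where "mpoly_const a = Poly_Mapping.single 0 a"

definition monomial_degree :: "('n::finite \<Rightarrow>\<^sub>0 nat) \<Rightarrow> nat"
  where "monomial_degree \<mu> = (\<Sum>i\<in>UNIV. Poly_Mapping.lookup \<mu> i)"

text \<open>Degrees are integers because of the twists below; the component of negative degree is zero.\<close>

definition homogeneous_component :: "int \<Rightarrow> ('n::finite, 'k::field) mpoly set"
  where "homogeneous_component m =
    {f. \<forall>\<mu>\<in>Poly_Mapping.keys f. int (monomial_degree \<mu>) = m}"

definition homogeneous_ideal :: "('n::finite, 'k::field) mpoly set \<Rightarrow> bool"
  where "homogeneous_ideal I \<longleftrightarrow>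
    (\<exists>G \<subseteq> (\<Union>m. homogeneous_component m). I = Idl\<^bsub>mpoly_ring\<^esub> G)"

definition irrelevant_ideal :: "('n::finite, 'k::field) mpoly set"
  where "irrelevant_ideal = Idl\<^bsub>mpoly_ring\<^esub> (range mpoly_var)"


section \<open>Grade\<close>

definition regular_sequence :: "('a, 'm) ring_scheme \<Rightarrow> 'a list \<Rightarrow> bool"
  where "regular_sequence A xs \<longleftrightarrow>
    set xs \<subseteq> carrier A \<and>
    (\<forall>i<length xs. \<forall>f\<in>carrier A.
       xs ! i \<otimes>\<^bsub>A\<^esub> f \<in> Idl\<^bsub>A\<^esub> (set (take i xs)) \<longrightarrow> f \<in> Idl\<^bsub>A\<^esub> (set (take i xs))) \<and>
    Idl\<^bsub>A\<^esub> (set xs) \<noteq> carrier A"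

definition grade :: "('a, 'm) ring_scheme \<Rightarrow> 'a set \<Rightarrow> enat"
  where "grade A I = (SUP xs \<in> {xs. regular_sequence A xs \<and> set xs \<subseteq> I}. enat (length xs))"


section \<open>Module homomorphisms and exactness\<close>

definition module_hom ::
    "('r, 'm) ring_scheme \<Rightarrow> ('r, 'a) module \<Rightarrow> ('r, 'b) module \<Rightarrow> ('a \<Rightarrow> 'b) set"
  where "module_hom A M N = {f \<in> carrier M \<rightarrow> carrier N.
    (\<forall>x\<in>carrier M. \<forall>y\<in>carrier M. f (x \<oplus>\<^bsub>M\<^esub> y) = f x \<oplus>\<^bsub>N\<^esub> f y) \<and>
    (\<forall>r\<in>carrier A. \<forall>x\<in>carrier M. f (r \<odot>\<^bsub>M\<^esub> x) = r \<odot>\<^bsub>N\<^esub> f x)}"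

text \<open>Exactness of \<open>L \<rightarrow> M \<rightarrow> N\<close> at \<open>M\<close>.\<close>

definition exact_at ::
    "('r, 'a) module \<Rightarrow> ('a \<Rightarrow> 'b) \<Rightarrow> ('r, 'b) module \<Rightarrow> ('b \<Rightarrow> 'c) \<Rightarrow> ('r, 'c) module \<Rightarrow> bool"
  where "exact_at L f M g N \<longleftrightarrow> f ` carrier L = {y \<in> carrier M. g y = \<zero>\<^bsub>N\<^esub>}"


section \<open>Gorenstein rings\<close>

text \<open>The localization \<open>A\<^sub>P\<close> at a prime ideal \<open>P\<close>; its elements are the classes of the
  pairs \<open>(a, s)\<close>, read as fractions \<open>a / s\<close>.\<close>

definition fraction_rel :: "('a, 'm) ring_scheme \<Rightarrow> 'a set \<Rightarrow> (('a \<times> 'a) \<times> ('a \<times> 'a)) set"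
  where "fraction_rel A P = {((a, s), (b, t)).
    a \<in> carrier A \<and> b \<in> carrier A \<and> s \<in> carrier A - P \<and> t \<in> carrier A - P \<and>
    (\<exists>u \<in> carrier A - P. u \<otimes>\<^bsub>A\<^esub> (a \<otimes>\<^bsub>A\<^esub> t) = u \<otimes>\<^bsub>A\<^esub> (b \<otimes>\<^bsub>A\<^esub> s))}"

definition localization :: "('a, 'm) ring_scheme \<Rightarrow> 'a set \<Rightarrow> ('a \<times> 'a) set ring"
  where "localization A P =
    \<lparr>carrier = (carrier A \<times> (carrier A - P)) // fraction_rel A P,
     monoid.mult = (\<lambda>u v. \<Union>(a, s)\<in>u. \<Union>(b, t)\<in>v. fraction_rel A P `` {(a \<otimes>\<^bsub>A\<^esub> b, s \<otimes>\<^bsub>A\<^esub> t)}),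
     one = fraction_rel A P `` {(\<one>\<^bsub>A\<^esub>, \<one>\<^bsub>A\<^esub>)},
     zero = fraction_rel A P `` {(\<zero>\<^bsub>A\<^esub>, \<one>\<^bsub>A\<^esub>)},
     add = (\<lambda>u v. \<Union>(a, s)\<in>u. \<Union>(b, t)\<in>v.
       fraction_rel A P `` {((a \<otimes>\<^bsub>A\<^esub> t) \<oplus>\<^bsub>A\<^esub> (b \<otimes>\<^bsub>A\<^esub> s), s \<otimes>\<^bsub>A\<^esub> t)})\<rparr>"

definition regular_module :: "('a, 'm) ring_scheme \<Rightarrow> ('a, 'a) module"
  where "regular_module A = \<lparr>carrier = carrier A, monoid.mult = monoid.mult A, one = one A, zero = zero A,
    add = add A, module.smult = monoid.mult A\<rparr>"

text \<open>A definition in HOL cannot quantify over all types, so the test modules \<open>M\<close>, \<open>N\<close> are those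
  whose elements have the type of the ring elements. This loses nothing: by Baer's criterion it
  suffices to test the inclusions of ideals \<open>J \<subseteq> A\<close>, which are of this kind.\<close>

definition injective_module :: "('a, 'm) ring_scheme \<Rightarrow> ('a, 'e) module \<Rightarrow> bool"
  where "injective_module A E \<longleftrightarrow> module A E \<and>
    (\<forall>(M :: ('a, 'a) module) (N :: ('a, 'a) module) f g.
       module A M \<and> module A N \<and> f \<in> module_hom A M N \<and> inj_on f (carrier M) \<and>
       g \<in> module_hom A M E \<longrightarrow>
       (\<exists>h\<in>module_hom A N E. \<forall>x\<in>carrier M. h (f x) = g x))"

text \<open>Finite injective dimension of \<open>A\<close> as an \<open>A\<close>-module: there is an injective resolution
  \<open>0 \<rightarrow> A \<rightarrow> E 0 \<rightarrow> E 1 \<rightarrow> \<dots>\<close> with \<open>E i = 0\<close> for \<open>i > d\<close>. The type \<open>'a list\<close> is large enough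
  to carry it: over a Noetherian ring \<open>A\<close> the terms of the minimal injective resolution of \<open>A\<close>
  have cardinality at most the maximum of \<open>|A|\<close> and \<open>\<aleph>\<^sub>0\<close>.\<close>

definition finite_self_injective_dimension :: "('a, 'm) ring_scheme \<Rightarrow> bool"
  where "finite_self_injective_dimension A \<longleftrightarrow>
    (\<exists>(d :: nat) (E :: nat \<Rightarrow> ('a, 'a list) module) \<eta> \<delta>.
       (\<forall>i. injective_module A (E i)) \<and>
       (\<forall>i>d. carrier (E i) = {\<zero>\<^bsub>E i\<^esub>}) \<and>
       \<eta> \<in> module_hom A (regular_module A) (E 0) \<and> inj_on \<eta> (carrier A) \<and>
       (\<forall>i. \<delta> i \<in> module_hom A (E i) (E (Suc i))) \<and>
       exact_at (regular_module A) \<eta> (E 0) (\<delta> 0) (E 1) \<and>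
       (\<forall>i. exact_at (E i) (\<delta> i) (E (Suc i)) (\<delta> (Suc i)) (E (Suc (Suc i)))))"

definition gorenstein_ring :: "('a, 'm) ring_scheme \<Rightarrow> bool"
  where "gorenstein_ring A \<longleftrightarrow> cring A \<and> noetherian_ring A \<and>
    (\<forall>P. maximalideal P A \<longrightarrow> finite_self_injective_dimension (localization A P))"


section \<open>Minimal graded free resolutions\<close>

text \<open>A list \<open>d\<close> of integers stands for the graded free module \<open>\<Oplus>\<^sub>j R(-d ! j)\<close>, whose elements
  are the vectors supported on \<open>{..<length d}\<close>. The ring multiplication and unit of the record are
  irrelevant for a module.\<close>

definition free_module :: "int list \<Rightarrow> (('n::finite, 'k::field) mpoly, nat \<Rightarrow> ('n, 'k) mpoly) module"
  where "free_module d =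
    \<lparr>carrier = {v. \<forall>j\<ge>length d. v j = 0}, monoid.mult = undefined, one = undefined,
     zero = (\<lambda>_. 0), add = (\<lambda>v w j. v j + w j), module.smult = (\<lambda>f v j. f * v j)\<rparr>"

definition free_module_component :: "int list \<Rightarrow> int \<Rightarrow> (nat \<Rightarrow> ('n::finite, 'k::field) mpoly) set"
  where "free_module_component d m =
    {v \<in> carrier (free_module d). \<forall>j<length d. v j \<in> homogeneous_component (m - d ! j)}"

text \<open>\<open>\<dots> \<rightarrow> F 2 \<rightarrow> F 1 \<rightarrow> F 0 = R\<close> is a minimal graded free resolution of \<open>R/I\<close>, where
  \<open>F i\<close> is the free module with list of shifts \<open>D i\<close>, the map \<open>\<phi> i\<close> goes from \<open>F i\<close> to
  \<open>F (i - 1)\<close>, and \<open>R \<rightarrow> R/I\<close> is the canonical projection. The last clause says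
  \<open>\<phi> i (F i) \<subseteq> \<mm> F (i - 1)\<close> for the irrelevant ideal \<open>\<mm>\<close>.\<close>

definition minimal_graded_free_resolution ::
    "('n::finite, 'k::field) mpoly set \<Rightarrow> (nat \<Rightarrow> int list) \<Rightarrow>
     (nat \<Rightarrow> (nat \<Rightarrow> ('n, 'k) mpoly) \<Rightarrow> (nat \<Rightarrow> ('n, 'k) mpoly)) \<Rightarrow> bool"
  where "minimal_graded_free_resolution I D \<phi> \<longleftrightarrow>
    D 0 = [0] \<and>
    (\<forall>i. \<phi> (Suc i) \<in> module_hom mpoly_ring (free_module (D (Suc i))) (free_module (D i))) \<and>
    (\<forall>i m. \<phi> (Suc i) ` free_module_component (D (Suc i)) m \<subseteq> free_module_component (D i) m) \<and>
    \<phi> 1 ` carrier (free_module (D 1)) = {v \<in> carrier (free_module (D 0)). v 0 \<in> I} \<and>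
    (\<forall>i. exact_at (free_module (D (Suc (Suc i)))) (\<phi> (Suc (Suc i)))
      (free_module (D (Suc i))) (\<phi> (Suc i)) (free_module (D i))) \<and>
    (\<forall>i. \<forall>v\<in>carrier (free_module (D (Suc i))). \<forall>j. \<phi> (Suc i) v j \<in> irrelevant_ideal)"

text \<open>The shifts of a self-dual resolution of length \<open>2k\<close>: the module in homological degree \<open>i\<close>
  is \<open>\<Oplus>\<^sub>j R(-a\<^sub>i\<^sub>j)\<close> for \<open>0 < i < k\<close>, it is \<open>\<Oplus>\<^sub>j R(-(c - a\<^sub>k\<^sub>j)) \<oplus> \<Oplus>\<^sub>j R(-a\<^sub>k\<^sub>j)\<close> for \<open>i = k\<close>, and
  \<open>\<Oplus>\<^sub>j R(-(c - a\<^sub>i'\<^sub>j))\<close> with \<open>i' = 2k - i\<close> for \<open>k < i < 2k\<close>; here \<open>1 \<le> j \<le> r\<^sub>i\<close>.\<close>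

definition symmetric_shifts ::
    "nat \<Rightarrow> int \<Rightarrow> (nat \<Rightarrow> nat) \<Rightarrow> (nat \<Rightarrow> nat \<Rightarrow> int) \<Rightarrow> nat \<Rightarrow> int list"
  where "symmetric_shifts k c r a i =
    (let lower = (\<lambda>i. map (\<lambda>j. a i j) [1..<Suc (r i)]);
         upper = (\<lambda>i. map (\<lambda>j. c - a i j) [1..<Suc (r i)])
     in if i = 0 then [0]
        else if i < k then lower i
        else if i = k then upper k @ lower k
        else if i < 2 * k then upper (2 * k - i)
        else if i = 2 * k then [c]
        else [])"


section \<open>Hilbert series and Hilbert coefficients\<close>

text \<open>\<open>dim\<^sub>K S\<^sub>i\<close> for \<open>S = R/I\<close>, computed inside the ring \<open>S\<close>: the scalars are the image of \<open>K\<close>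
  in \<open>S\<close>, and \<open>S\<^sub>i\<close> is the image of \<open>R\<^sub>i\<close>.\<close>

definition hilbert_function :: "('n::finite, 'k::field) mpoly set \<Rightarrow> nat \<Rightarrow> nat"
  where "hilbert_function I i =
    ring.dim (mpoly_ring Quot I)
      ((\<lambda>f. I +>\<^bsub>mpoly_ring\<^esub> f) ` range mpoly_const)
      ((\<lambda>f. I +>\<^bsub>mpoly_ring\<^esub> f) ` homogeneous_component (int i))"

definition hilbert_series :: "('n::finite, 'k::field) mpoly set \<Rightarrow> rat fps"
  where "hilbert_series I = Abs_fps (\<lambda>i. of_nat (hilbert_function I i))"

text \<open>The polynomial \<open>Q\<close> with \<open>\<Sum>\<^sub>i dim\<^sub>K(S\<^sub>i) t\<^sup>i = Q(t) / (1 - t)\<^sup>d\<close>.\<close>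

definition hilbert_numerator :: "('n::finite, 'k::field) mpoly set \<Rightarrow> nat \<Rightarrow> rat poly"
  where "hilbert_numerator I d =
    (THE Q. hilbert_series I = fps_of_poly Q / (1 - fps_X) ^ d)"

definition hilbert_coefficient :: "('n::finite, 'k::field) mpoly set \<Rightarrow> nat \<Rightarrow> nat \<Rightarrow> rat"
  where "hilbert_coefficient I d l = poly ((pderiv ^^ l) (hilbert_numerator I d)) 1 / fact l"


section \<open>Elementary symmetric numbers\<close>

definition elementary_symmetric :: "nat \<Rightarrow> nat \<Rightarrow> nat"
  where "elementary_symmetric N m = (\<Sum>\<xi> | \<xi> \<subseteq> {1..N} \<and> card \<xi> = m. \<Prod>\<xi>)"

end

theory Submission
  imports Defs "HOL-Library.Function_Algebras"
begin

text \<open>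
  Let \<open>P(t)\<close> be the alternating sum of the \<open>t\<^sup>d\<close> over all shifts \<open>d\<close> of the resolution. Exactness in
  each degree gives \<open>P(t) / (1 - t)\<^sup>n\<close> for the Hilbert series. A regular sequence of length \<open>s\<close> in \<open>I\<close>
  bounds the partial sums of the Hilbert function by a multiple of \<open>m\<close> to the power \<open>n - s\<close>, which
  forces \<open>(1 - t)\<^sup>s\<close> to divide \<open>P\<close>. Hence the Taylor coefficients of \<open>P\<close> at \<open>1\<close> of order less than \<open>s\<close> vanish,
  and the one of order \<open>s + l\<close> is \<open>e\<^sub>l\<close>. These coefficients are alternating sums of binomials in
  the shifts; expanding the falling factorials turns them into power sums, those of exponent
  less than \<open>s\<close> being zero. As the shifts come in pairs \<open>x\<close>, \<open>c - x\<close>, Waring's formula expresses the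
  power sums through \<open>c\<close> and the products \<open>x (c - x)\<close>.
\<close>

section \<open>Dimensions in vector spaces\<close>

text \<open>The grade is witnessed by regular sequences of arbitrary polynomials, not necessarily
  homogeneous, so the growth bound is proved for the filtration by total degree instead of the
  grading. There a regular element yields only an inequality between affine Hilbert functions, but
  an upper bound is all that is wanted: a pole of the Hilbert series at 1 of order greater than
  \<open>n - s\<close> would make its partial sums grow too fast. For \<open>I\<close> itself, which
  is closed under homogeneous parts, those partial sums are the affine Hilbert function, and the two
  views meet.

  The vanishing of the low power sums acts once more after Waring's formula: it makes the
  alternating sums of \<open>(x * (c - x)) ^ t\<close> vanish for \<open>0 < t < k\<close>, and for
  \<open>t = 0\<close> it cancels the contribution of the two end modules. This is why only the
  exponents \<open>k + t\<close> occur in the result.\<close>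

lemma (in vector_space) dim_mono_finite:
  assumes "V \<subseteq> W" "W \<subseteq> span S" "finite S"
  shows "dim V \<le> dim W"
proof -
  obtain B where B: "B \<subseteq> V" "independent B" "V \<subseteq> span B" "card B = dim V"
    by (rule basis_exists[of V])
  obtain C where C: "C \<subseteq> W" "independent C" "W \<subseteq> span C" "card C = dim W"
    by (rule basis_exists[of W])
  \<comment> \<open>\<open>dim\<close> is a cardinality in \<open>nat\<close>, hence 0 in infinite
    dimension; the finite set \<open>S\<close> rules this out. The polynomial ring is
    infinite-dimensional, so such spanning sets accompany the dimension arguments below.\<close>
  have "finite C"
    using independent_span_bound[OF assms(3) C(2)] C(1) assms(2) by blast
  moreover have "B \<subseteq> span C"
    using B(1) C(3) assms(1) by blast
  ultimately show ?thesis
    using independent_span_bound[OF _ B(2)] B(4) C(4) by metis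
qed

text \<open>An indexed family and hypotheses about coefficients suit monomial bases, where the
  coefficients of a linear combination can be read off. Injectivity of \<open>b\<close> comes out of
  \<open>indep\<close>.\<close>

lemma (in vector_space) dim_eq_card_family:
  assumes "finite A" "subspace E" "\<And>x. x \<in> A \<Longrightarrow> b x \<in> E"
    and "\<And>v. v \<in> E \<Longrightarrow> \<exists>a. v = (\<Sum>x\<in>A. scale (a x) (b x))"
    and indep: "\<And>a. (\<Sum>x\<in>A. scale (a x) (b x)) = 0 \<Longrightarrow> \<forall>x\<in>A. a x = 0"
  shows "dim E = card A" "E \<subseteq> span (b ` A)"
proof -
  have inj: "inj_on b A"
  proof (rule inj_onI, rule ccontr)
    fix x y assume xy: "x \<in> A" "y \<in> A" "b x = b y" "x \<noteq> y"
    \<comment> \<open>Two indices with the same vector would give the nontrivial relation with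
      coefficients 1 and -1.\<close>
    define a where "a = (\<lambda>z. if z = x then 1 else if z = y then - 1 else 0 :: 'a)"
    have "(\<Sum>z\<in>A. scale (a z) (b z)) = (\<Sum>z\<in>{x,y}. scale (a z) (b z))"
      using xy assms(1) by (intro sum.mono_neutral_right) (auto simp: a_def)
    also have "\<dots> = 0"
      using xy by (simp add: a_def)
    finally show False
      using indep[of a] xy by (auto simp: a_def)
  qed
  show sp: "E \<subseteq> span (b ` A)"
  proof
    fix v assume "v \<in> E"
    then obtain a where v: "v = (\<Sum>x\<in>A. scale (a x) (b x))"
      using assms(4) by blast
    show "v \<in> span (b ` A)"
      unfolding v by (intro span_sum span_scale span_base) simp
  qed
  have ind: "independent (b ` A)"
  proof (rule independent_if_scalars_zero)
    show "finite (b ` A)" using assms(1) by simp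
    fix f x assume *: "(\<Sum>x\<in>b ` A. scale (f x) x) = 0" "x \<in> b ` A"
    have "(\<Sum>x\<in>A. scale (f (b x)) (b x)) = 0"
      using *(1) inj by (simp add: sum.reindex)
    from indep[of "\<lambda>x. f (b x)", OF this] *(2) show "f x = 0" by auto
  qed
  have "dim E = card (b ` A)"
    by (rule dim_unique[of "b ` A"]) (use assms(3) sp ind in auto)
  then show "dim E = card A"
    using inj by (simp add: card_image)
qed

text \<open>Rank-nullity on a subspace: a basis \<open>A\<close> of the kernel is extended to a
  basis \<open>B\<close> of \<open>V\<close>, and \<open>f\<close> maps \<open>C = B - A\<close>
  injectively onto a basis of the image.\<close>

lemma (in vector_space_pair) dim_eq_dim_kernel_plus_dim_image:
  assumes lf: "Vector_Spaces.linear s1 s2 f" and V: "vs1.subspace V" and S: "V \<subseteq> vs1.span S" "finite S"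
  shows "vs1.dim V = vs1.dim {v \<in> V. f v = 0} + vs2.dim (f ` V)"
proof -
  interpret f: Vector_Spaces.linear s1 s2 f by (rule lf)
  let ?N = "{v \<in> V. f v = 0}"
  have N: "vs1.subspace ?N"
    using V by (auto simp: vs1.subspace_def f.add f.scale)
  obtain A where A: "A \<subseteq> ?N" "vs1.independent A" "?N \<subseteq> vs1.span A" "card A = vs1.dim ?N"
    by (rule vs1.basis_exists[of ?N])
  obtain B where B: "A \<subseteq> B" "B \<subseteq> V" "vs1.independent B" "V \<subseteq> vs1.span B"
    using vs1.maximal_independent_subset_extend[of A V] A by blast
  have finB: "finite B"
    using vs1.independent_span_bound[OF S(2) B(3)] B(2) S(1) by blast
  define C where "C = B - A"
  have BV: "vs1.span B = V"
    using B V by (metis vs1.span_subspace)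
  have spC: "vs1.span C \<inter> ?N \<subseteq> {0}"
  proof
    fix v assume v: "v \<in> vs1.span C \<inter> ?N"
    have finC: "finite C" and finA: "finite A" using finB B(1) by (auto simp: C_def intro: finite_subset)
    obtain u where u: "v = (\<Sum>c\<in>C. s1 (u c) c)"
      using v vs1.span_finite[OF finC] by auto
    obtain w where w: "v = (\<Sum>c\<in>A. s1 (w c) c)"
      using v A(3) vs1.span_finite[OF finA] by auto
    \<comment> \<open>The difference of the two expansions of \<open>v\<close>, over
      \<open>C\<close> and over \<open>A\<close>, is a relation on the independent set
      \<open>B\<close>.\<close>
    define g where "g = (\<lambda>x. if x \<in> A then - w x else u x)"
    have "(\<Sum>x\<in>B. s1 (g x) x) = (\<Sum>x\<in>C. s1 (g x) x) + (\<Sum>x\<in>A. s1 (g x) x)"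
      unfolding C_def by (rule sum.subset_diff[OF B(1) finB])
    also have "\<dots> = v + - v"
      by (subst (2) w, subst u) (auto simp: g_def C_def sum_negf intro!: arg_cong2[of _ _ _ _ "(+)"] sum.cong)
    finally have "(\<Sum>x\<in>B. s1 (g x) x) = 0" by simp
    then have *: "\<forall>x\<in>B. g x = 0"
      using B(3) finB vs1.independentD[OF B(3) finB subset_refl] by blast
    have "w x = 0" if "x \<in> A" for x
      using bspec[OF *, of x] that B(1) by (auto simp: g_def)
    then show "v \<in> {0}" using w by simp
  qed
  have injC: "inj_on f (vs1.span C)"
  proof (rule inj_onI)
    fix x y assume xy: "x \<in> vs1.span C" "y \<in> vs1.span C" "f x = f y"
    have "x - y \<in> V"
      using xy BV vs1.span_mono[of C B] V by (auto simp: C_def intro!: vs1.subspace_diff)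
    then have "x - y \<in> vs1.span C \<inter> ?N"
      using xy by (auto simp: f.diff vs1.span_diff)
    then show "x = y" using spC by auto
  qed
  have indC: "vs1.independent C"
    using B(3) by (rule vs1.independent_mono) (auto simp: C_def)
  have indfC: "vs2.independent (f ` C)"
    by (rule f.independent_injective_image[OF indC injC])
  have "f ` V \<subseteq> vs2.span (f ` C)"
  proof -
    have "f ` V = vs2.span (f ` B)"
      by (simp add: f.span_image BV)
    also have "\<dots> \<subseteq> vs2.span (f ` C)"
    proof (rule vs2.span_minimal[OF _ vs2.subspace_span], rule image_subsetI)
      fix b assume b: "b \<in> B"
      show "f b \<in> vs2.span (f ` C)"
      proof (cases "b \<in> A")
        case True
        then have "f b = 0" using A(1) by auto
        then show ?thesis by (simp add: vs2.span_zero)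
      qed (use b in \<open>auto simp: C_def intro: vs2.span_base\<close>)
    qed
    finally show ?thesis .
  qed
  moreover have "f ` C \<subseteq> f ` V"
    using B(2) by (auto simp: C_def)
  moreover have "card (f ` C) = card C"
    by (intro card_image inj_on_subset[OF injC] vs1.span_superset)
  ultimately have "vs2.dim (f ` V) = card C"
    using indfC by (metis vs2.dim_unique)
  moreover have "vs1.dim V = card B"
    by (rule vs1.dim_unique[OF B(2) B(4) B(3) refl])
  moreover have "card B = card A + card C"
    using finB B(1) unfolding C_def by (metis card_Diff_subset card_mono finite_subset le_add_diff_inverse)
  ultimately show ?thesis using A(4) by simp
qed

text \<open>The projection that kills a basis of \<open>U\<close> and fixes the remaining vectors of
  an extended basis. It replaces the quotient map by \<open>U\<close> without a new type.\<close>

lemma (in vector_space) exists_linear_with_kernel: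
  assumes "subspace U"
  shows "\<exists>g. Vector_Spaces.linear scale scale g \<and> (\<forall>v. g v = 0 \<longleftrightarrow> v \<in> U)"
proof -
  interpret vector_space_pair scale scale by unfold_locales
  obtain A where A: "A \<subseteq> U" "independent A" "U \<subseteq> span A" "card A = dim U"
    by (rule basis_exists[of U])
  obtain B where B: "A \<subseteq> B" "independent B" "UNIV \<subseteq> span B"
    by (rule maximal_independent_subset_extend[OF subset_UNIV A(2)])
  define g where "g = construct B (\<lambda>b. if b \<in> A then 0 else b)"
  have lin: "Vector_Spaces.linear scale scale g"
    unfolding g_def by (rule linear_construct[OF B(2)])
  interpret g: Vector_Spaces.linear scale scale g by (rule lin)
  have gb: "g b = (if b \<in> A then 0 else b)" if "b \<in> B" for b
    unfolding g_def using construct_basis[OF B(2) that] .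
  have AU: "span A = U"
    using A assms by (metis span_subspace)
  have 0: "g v = 0" if "v \<in> U" for v
  proof -
    have "g v = 0" if "v \<in> span A" for v
      using that
    proof (induction rule: span_induct_alt)
      case (step c x y)
      then show ?case using gb[of x] B(1) by (auto simp: g.add g.scale)
    qed simp
    then show ?thesis using that AU by simp
  qed
  \<comment> \<open>Hence \<open>g v = 0\<close> forces \<open>v\<close> into
    \<open>U\<close>.\<close>
  have "v - g v \<in> U" for v
  proof -
    have "v \<in> span B" using B(3) by auto
    then show ?thesis
    proof (induction rule: span_induct_alt)
      case base
      then show ?case using assms by (simp add: subspace_0)
    next
      case (step c x y)
      have "x - g x \<in> U"
        using gb[OF step(1)] assms A(1) by (auto simp: subspace_0)
      then have "scale c (x - g x) + (y - g y) \<in> U"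
        using step assms by (simp add: subspace_add subspace_scale)
      also have "scale c (x - g x) + (y - g y) = scale c x + y - g (scale c x + y)"
        by (simp add: g.add g.scale scale_right_diff_distrib)
      finally show ?case .
    qed
  qed
  from this[of v for v] 0 lin show ?thesis
    by (metis diff_zero)
qed

text \<open>The hypotheses say that \<open>f\<close> induces an injection \<open>V / U \<rightarrow> V' / U'\<close>.\<close>

lemma (in vector_space) codim_le:
  assumes f: "Vector_Spaces.linear scale scale f" and V: "subspace V" and V': "subspace V'" "V' \<subseteq> span S" "finite S"
    and fV: "f ` V \<subseteq> V'" "V \<subseteq> span T" "finite T"
    and U: "U \<subseteq> V" and U': "subspace U'" "U' \<subseteq> V'"
    and inj: "\<And>v. v \<in> V \<Longrightarrow> f v \<in> U' \<Longrightarrow> v \<in> U"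
  shows "dim V + dim U' \<le> dim V' + dim U"
proof -
  interpret vector_space_pair scale scale by unfold_locales
  \<comment> \<open>Under \<open>g\<close>, the image of \<open>V'\<close> is a copy of
    \<open>V' / U'\<close>; by \<open>inj\<close> the kernel of \<open>g \<circ> f\<close> on
    \<open>V\<close> lies in \<open>U\<close>.\<close>
  obtain g where g: "Vector_Spaces.linear scale scale g" "\<And>v. g v = 0 \<longleftrightarrow> v \<in> U'"
    using exists_linear_with_kernel[OF U'(1)] by blast
  interpret f: Vector_Spaces.linear scale scale f by (rule f)
  interpret g: Vector_Spaces.linear scale scale g by (rule g)
  have gf: "Vector_Spaces.linear scale scale (g \<circ> f)"
    using Vector_Spaces.linear_compose[OF f g(1)] .
  have 1: "dim V' = dim U' + dim (g ` V')"
  proof -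
    have "{v \<in> V'. g v = 0} = U'" using U'(2) g(2) by auto
    then show ?thesis
      using dim_eq_dim_kernel_plus_dim_image[OF g(1) V'] by simp
  qed
  have 2: "dim V = dim {v \<in> V. (g \<circ> f) v = 0} + dim ((g \<circ> f) ` V)"
    by (rule dim_eq_dim_kernel_plus_dim_image[OF gf V fV(2,3)])
  have 3: "dim {v \<in> V. (g \<circ> f) v = 0} \<le> dim U"
    using inj g(2) U fV by (intro dim_mono_finite[of _ U T]) auto
  have "g ` V' \<subseteq> span (g ` S)"
    using V'(2) g.span_image[of S] by auto
  then have "dim ((g \<circ> f) ` V) \<le> dim (g ` V')"
    using fV(1) V'(3) by (intro dim_mono_finite[of _ _ "g ` S"]) auto
  with 1 2 3 show ?thesis by linarith
qed

section \<open>Graded pieces of the polynomial ring\<close>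

lemma sum_fun_apply: "(\<Sum>x\<in>A. f x) j = (\<Sum>x\<in>A. f x j)"
  by (induction A rule: infinite_finite_induct) auto

text \<open>Scalars act through multiplication by constants, so ideals are subspaces and module
  homomorphisms are linear over the field.\<close>

definition poly_scale :: "'k \<Rightarrow> ('n::finite, 'k::field) mpoly \<Rightarrow> ('n, 'k) mpoly"
  where "poly_scale a f = mpoly_const a * f"

definition vec_scale :: "'k \<Rightarrow> (nat \<Rightarrow> ('n::finite, 'k::field) mpoly) \<Rightarrow> nat \<Rightarrow> ('n, 'k) mpoly"
  where "vec_scale a v = (\<lambda>j. mpoly_const a * v j)"

lemma lookup_poly_scale [simp]: "Poly_Mapping.lookup (poly_scale a f) \<mu> = a * Poly_Mapping.lookup f \<mu>"
  unfolding poly_scale_def mpoly_const_def mult_map_scale_conv_mult[symmetric]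
  by (simp add: Poly_Mapping.map.rep_eq when_def)

lemma vec_scale_apply [simp]: "vec_scale a v j = poly_scale a (v j)"
  by (simp add: vec_scale_def poly_scale_def)

interpretation polys: vector_space poly_scale
  by standard (auto intro!: poly_mapping_eqI simp: lookup_add algebra_simps)

interpretation vecs: vector_space vec_scale
  by standard (auto simp: fun_eq_iff intro!: poly_mapping_eqI simp: lookup_add algebra_simps)

interpretation vecs_vecs: vector_space_pair vec_scale vec_scale
  by unfold_locales

interpretation vecs_polys: vector_space_pair vec_scale poly_scale
  by unfold_locales

interpretation polys_polys: vector_space_pair poly_scale poly_scale
  by unfold_locales

text \<open>Homogeneous components and polynomials of bounded degree are both cut out by a condition
  on the monomials, so one computation gives both dimensions.\<close>

definition supported_polys :: "('n::finite \<Rightarrow>\<^sub>0 nat) set \<Rightarrow> ('n, 'k::field) mpoly set"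
  where "supported_polys M = {f. Poly_Mapping.keys f \<subseteq> M}"

definition supported_vecs ::
    "(nat \<times> ('n::finite \<Rightarrow>\<^sub>0 nat)) set \<Rightarrow> (nat \<Rightarrow> ('n, 'k::field) mpoly) set"
  where "supported_vecs M = {v. \<forall>j. \<forall>\<mu>\<in>Poly_Mapping.keys (v j). (j, \<mu>) \<in> M}"

lemma supported_polys_iff:
  "f \<in> supported_polys M \<longleftrightarrow> (\<forall>\<mu>. \<mu> \<notin> M \<longrightarrow> Poly_Mapping.lookup f \<mu> = 0)"
  by (auto simp: supported_polys_def in_keys_iff)

lemma supported_vecs_iff:
  "v \<in> supported_vecs M \<longleftrightarrow> (\<forall>j \<mu>. (j, \<mu>) \<notin> M \<longrightarrow> Poly_Mapping.lookup (v j) \<mu> = 0)"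
  unfolding supported_vecs_def Ball_def mem_Collect_eq in_keys_iff by blast

lemma subspace_supported_polys: "polys.subspace (supported_polys M)"
  by (auto simp: polys.subspace_def supported_polys_iff lookup_add)

lemma subspace_supported_vecs: "vecs.subspace (supported_vecs M)"
  by (auto simp: vecs.subspace_def supported_vecs_iff lookup_add)

lemma supported_polys_dim:
  assumes "finite M"
  shows "polys.dim (supported_polys M :: ('n::finite, 'k::field) mpoly set) = card M"
    and "(supported_polys M :: ('n, 'k) mpoly set) \<subseteq>
      polys.span ((\<lambda>\<mu>. Poly_Mapping.single \<mu> 1) ` M)"
proof -
  let ?b = "\<lambda>\<mu>. Poly_Mapping.single \<mu> 1 :: ('n, 'k) mpoly"
  have l: "Poly_Mapping.lookup (\<Sum>\<mu>\<in>M. poly_scale (a \<mu>) (?b \<mu>)) \<nu> = (if \<nu> \<in> M then a \<nu> else 0)" for a \<nu>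
    using assms by (simp add: lookup_sum lookup_single when_def if_distrib[of "\<lambda>x. _ * x"] cong: if_cong)
  have 1: "?b \<mu> \<in> supported_polys M" if "\<mu> \<in> M" for \<mu>
    using that by (auto simp: supported_polys_iff lookup_single when_def)
  have 2: "\<exists>a. f = (\<Sum>\<mu>\<in>M. poly_scale (a \<mu>) (?b \<mu>))" if "f \<in> supported_polys M" for f
    using that by (intro exI[of _ "Poly_Mapping.lookup f"] poly_mapping_eqI)
      (simp add: l supported_polys_iff)
  have 3: "\<forall>\<mu>\<in>M. a \<mu> = 0" if "(\<Sum>\<mu>\<in>M. poly_scale (a \<mu>) (?b \<mu>)) = 0" for a
    using l[of a] unfolding that by (metis lookup_zero)
  show "polys.dim (supported_polys M :: ('n, 'k) mpoly set) = card M"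
    by (rule polys.dim_eq_card_family(1)[where b = ?b, OF assms subspace_supported_polys 1 2 3])
  show "(supported_polys M :: ('n, 'k) mpoly set) \<subseteq> polys.span (?b ` M)"
    by (rule polys.dim_eq_card_family(2)[where b = ?b, OF assms subspace_supported_polys 1 2 3])
qed

lemma supported_vecs_dim:
  assumes "finite M"
  shows "vecs.dim (supported_vecs M :: (nat \<Rightarrow> ('n::finite, 'k::field) mpoly) set) = card M"
    and "(supported_vecs M :: (nat \<Rightarrow> ('n, 'k) mpoly) set) \<subseteq>
      vecs.span ((\<lambda>y i. Poly_Mapping.single (snd y) (1 when i = fst y)) ` M)"
proof -
  let ?b = "\<lambda>y i. Poly_Mapping.single (snd y) (1 when i = fst y) :: ('n, 'k) mpoly"
  have l: "Poly_Mapping.lookup ((\<Sum>y\<in>M. vec_scale (a y) (?b y)) j) \<nu> = (if (j, \<nu>) \<in> M then a (j, \<nu>) else 0)" for a \<nu> j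
  proof -
    have "Poly_Mapping.lookup ((\<Sum>y\<in>M. vec_scale (a y) (?b y)) j) \<nu> = (\<Sum>y\<in>M. if y = (j, \<nu>) then a y else 0)"
      unfolding sum_fun_apply lookup_sum
      by (rule sum.cong) (auto simp: lookup_single when_def)
    then show ?thesis using assms by simp
  qed
  have 1: "?b y \<in> supported_vecs M" if "y \<in> M" for y
    using that by (auto simp: supported_vecs_iff lookup_single when_def)
  have 2: "\<exists>a. f = (\<Sum>y\<in>M. vec_scale (a y) (?b y))" if "f \<in> supported_vecs M" for f
    using that by (intro exI[of _ "\<lambda>y. Poly_Mapping.lookup (f (fst y)) (snd y)"] ext poly_mapping_eqI)
      (simp add: l supported_vecs_iff)
  have 3: "\<forall>y\<in>M. a y = 0" if "(\<Sum>y\<in>M. vec_scale (a y) (?b y)) = 0" for a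
  proof
    fix y assume "y \<in> M"
    then show "a y = 0"
      using l[of a "fst y" "snd y"] unfolding that by simp
  qed
  show "vecs.dim (supported_vecs M :: (nat \<Rightarrow> ('n, 'k) mpoly) set) = card M"
    by (rule vecs.dim_eq_card_family(1)[where b = ?b, OF assms subspace_supported_vecs 1 2 3])
  show "(supported_vecs M :: (nat \<Rightarrow> ('n, 'k) mpoly) set) \<subseteq> vecs.span (?b ` M)"
    by (rule vecs.dim_eq_card_family(2)[where b = ?b, OF assms subspace_supported_vecs 1 2 3])
qed

text \<open>Enumerating the variables turns exponent vectors into lists with a prescribed sum, for
  which a counting formula is available.\<close>

lemma bij_betw_monomials_lists:
  "\<exists>h :: ('n::finite \<Rightarrow>\<^sub>0 nat) \<Rightarrow> nat list.
    \<forall>m. bij_betw h {\<mu>. monomial_degree \<mu> = m} {xs. length xs = CARD('n) \<and> sum_list xs = m}"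
proof -
  obtain ns :: "'n list" where ns: "set ns = UNIV" "distinct ns"
    using finite_distinct_list[of "UNIV :: 'n set"] by auto
  then have len: "length ns = CARD('n)"
    by (metis distinct_card)
  define h where "h = (\<lambda>\<mu> :: 'n \<Rightarrow>\<^sub>0 nat. map (Poly_Mapping.lookup \<mu>) ns)"
  have "inj h"
  proof (rule injI)
    fix \<mu> \<nu> assume "h \<mu> = h \<nu>"
    then show "\<mu> = \<nu>"
      unfolding h_def using ns(1) by (intro poly_mapping_eqI) auto
  qed
  have "h ` {\<mu>. monomial_degree \<mu> = m} = {xs. length xs = CARD('n) \<and> sum_list xs = m}" for m
  proof (intro equalityI subsetI)
    fix xs assume "xs \<in> h ` {\<mu>. monomial_degree \<mu> = m}"
    then show "xs \<in> {xs. length xs = CARD('n) \<and> sum_list xs = m}"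
      using ns by (auto simp: h_def len monomial_degree_def sum_list_distinct_conv_sum_set)
  next
    fix xs :: "nat list" assume xs: "xs \<in> {xs. length xs = CARD('n) \<and> sum_list xs = m}"
    define \<mu> where "\<mu> = Abs_poly_mapping (\<lambda>i. the (map_of (zip ns xs) i))"
    have l: "Poly_Mapping.lookup \<mu> = (\<lambda>i. the (map_of (zip ns xs) i))"
      unfolding \<mu>_def by (rule lookup_Abs_poly_mapping) simp
    have "h \<mu> = xs"
      unfolding h_def l using xs ns(2) by (intro nth_equalityI) (simp_all add: len map_of_zip_nth)
    moreover have "monomial_degree \<mu> = sum_list (h \<mu>)"
      using ns by (simp add: h_def monomial_degree_def sum_list_distinct_conv_sum_set)
    ultimately show "xs \<in> h ` {\<mu>. monomial_degree \<mu> = m}"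
      using xs by (intro image_eqI[of _ _ \<mu>]) auto
  qed
  then show ?thesis
    using \<open>inj h\<close> by (intro exI[of _ h]) (auto simp: bij_betw_def intro: inj_on_subset)
qed

lemma finite_monomials_degree_eq: "finite {\<mu> :: 'n::finite \<Rightarrow>\<^sub>0 nat. monomial_degree \<mu> = m}"
proof -
  obtain h :: "('n \<Rightarrow>\<^sub>0 nat) \<Rightarrow> nat list"
    where h: "\<And>m. bij_betw h {\<mu>. monomial_degree \<mu> = m} {xs. length xs = CARD('n) \<and> sum_list xs = m}"
    using bij_betw_monomials_lists by blast
  have "{xs. length xs = CARD('n) \<and> sum_list xs = m} \<subseteq> {xs. set xs \<subseteq> {..m} \<and> length xs = CARD('n)}"
    using member_le_sum_list by fastforce
  then have "finite {xs. length xs = CARD('n) \<and> sum_list xs = m}"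
    using finite_subset finite_lists_length_eq by blast
  then show ?thesis
    using bij_betw_finite[OF h] by blast
qed

lemma card_monomials_degree_eq:
  "card {\<mu> :: 'n::finite \<Rightarrow>\<^sub>0 nat. monomial_degree \<mu> = m} = (m + CARD('n) - 1) choose m"
proof -
  obtain h :: "('n \<Rightarrow>\<^sub>0 nat) \<Rightarrow> nat list"
    where h: "\<And>m. bij_betw h {\<mu>. monomial_degree \<mu> = m} {xs. length xs = CARD('n) \<and> sum_list xs = m}"
    using bij_betw_monomials_lists by blast
  show ?thesis
    using bij_betw_same_card[OF h] card_length_sum_list by metis
qed

lemma finite_monomials_degree_le: "finite {\<mu> :: 'n::finite \<Rightarrow>\<^sub>0 nat. monomial_degree \<mu> \<le> m}"
proof -
  have "{\<mu> :: 'n \<Rightarrow>\<^sub>0 nat. monomial_degree \<mu> \<le> m} = (\<Union>i\<le>m. {\<mu>. monomial_degree \<mu> = i})"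
    by auto
  then show ?thesis
    by (simp add: finite_monomials_degree_eq)
qed

text \<open>Every exponent is at most \<open>m\<close>. The crude bound suffices because only the
  order of growth matters.\<close>

lemma card_monomials_degree_le:
  "card {\<mu> :: 'n::finite \<Rightarrow>\<^sub>0 nat. monomial_degree \<mu> \<le> m} \<le> (m + 1) ^ CARD('n)"
proof -
  let ?F = "UNIV \<rightarrow>\<^sub>E {..m} :: ('n \<Rightarrow> nat) set"
  have "Poly_Mapping.lookup ` {\<mu> :: 'n \<Rightarrow>\<^sub>0 nat. monomial_degree \<mu> \<le> m} \<subseteq> ?F"
  proof safe
    fix \<mu> :: "'n \<Rightarrow>\<^sub>0 nat" and i assume *: "monomial_degree \<mu> \<le> m"
    have "Poly_Mapping.lookup \<mu> i \<le> monomial_degree \<mu>"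
      unfolding monomial_degree_def by (rule member_le_sum) auto
    with * show "Poly_Mapping.lookup \<mu> i \<le> m" by linarith
  qed simp
  then have "card (Poly_Mapping.lookup ` {\<mu> :: 'n \<Rightarrow>\<^sub>0 nat. monomial_degree \<mu> \<le> m}) \<le> card ?F"
    by (intro card_mono finite_PiE) auto
  also have "card ?F = (m + 1) ^ CARD('n)"
    by (simp add: card_PiE)
  also have "card (Poly_Mapping.lookup ` {\<mu> :: 'n \<Rightarrow>\<^sub>0 nat. monomial_degree \<mu> \<le> m}) =
      card {\<mu> :: 'n \<Rightarrow>\<^sub>0 nat. monomial_degree \<mu> \<le> m}"
    by (intro card_image injI inj_onI) (simp add: lookup_inject)
  finally show ?thesis .
qed

text \<open>Multiplication by \<open>1 - fps_X\<close> takes differences, and Pascal's rule lowers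
  \<open>n\<close> by one. At \<open>n = 0\<close> truncated subtraction gives
  \<open>0 choose 0 = 1\<close> for \<open>m = 0\<close> and zero otherwise.\<close>

lemma fps_binomial_mult_one_minus_power:
  "Abs_fps (\<lambda>m. of_nat ((m + n - 1) choose m)) * (1 - fps_X) ^ n = (1 :: 'a::comm_ring_1 fps)"
proof (induction n)
  case 0
  show ?case
  proof (rule fps_ext)
    fix m show "fps_nth (Abs_fps (\<lambda>m. of_nat ((m + 0 - 1) choose m)) * (1 - fps_X) ^ 0) m = fps_nth (1 :: 'a fps) m"
      by (cases m) (simp_all add: binomial_eq_0)
  qed
next
  case (Suc n)
  have "Abs_fps (\<lambda>m. of_nat ((m + Suc n - 1) choose m)) * (1 - fps_X) =
      (Abs_fps (\<lambda>m. of_nat ((m + n - 1) choose m)) :: 'a fps)"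
  proof (rule fps_ext)
    fix m
    show "fps_nth (Abs_fps (\<lambda>m. of_nat ((m + Suc n - 1) choose m)) * (1 - fps_X)) m =
      fps_nth (Abs_fps (\<lambda>m. of_nat ((m + n - 1) choose m)) :: 'a fps) m"
      by (cases m) (simp_all add: right_diff_distrib)
  qed
  then show ?case
    using Suc.IH by (simp add: mult.assoc[symmetric])
qed

section \<open>Ideals and quotients of the polynomial ring\<close>

lemma mpoly_ring_simps [simp]:
  "carrier (mpoly_ring :: ('n::finite, 'k::field) mpoly ring) = UNIV"
  "x \<otimes>\<^bsub>mpoly_ring\<^esub> y = x * (y :: ('n, 'k) mpoly)"
  "x \<oplus>\<^bsub>mpoly_ring\<^esub> y = x + (y :: ('n, 'k) mpoly)"
  "\<one>\<^bsub>mpoly_ring\<^esub> = (1 :: ('n, 'k) mpoly)"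
  "\<zero>\<^bsub>mpoly_ring\<^esub> = (0 :: ('n, 'k) mpoly)"
  by (simp_all add: ring_of_type_algebra_def)

lemma ring_mpoly_ring: "ring (mpoly_ring :: ('n::finite, 'k::field) mpoly ring)"
  by (rule ring_from_type_algebra)

lemma mpoly_ideal_closed:
  assumes "ideal I (mpoly_ring :: ('n::finite, 'k::field) mpoly ring)"
  shows "0 \<in> I" "f \<in> I \<Longrightarrow> g \<in> I \<Longrightarrow> f + g \<in> I" "g \<in> I \<Longrightarrow> h * g \<in> I"
  using additive_subgroup.zero_closed[OF ideal.axioms(1)[OF assms]]
    additive_subgroup.a_closed[OF ideal.axioms(1)[OF assms], of f g]
    ideal.I_l_closed[OF assms, of g h]
  by simp_all

lemma subspace_ideal:
  assumes "ideal I (mpoly_ring :: ('n::finite, 'k::field) mpoly ring)"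
  shows "polys.subspace I"
  by (rule polys.subspaceI) (use mpoly_ideal_closed[OF assms] in \<open>simp_all add: poly_scale_def\<close>)

lemma mpoly_const_simps:
  "mpoly_const (a + b) = mpoly_const a + mpoly_const b"
  "mpoly_const (a * b) = mpoly_const a * mpoly_const b"
  "mpoly_const 1 = 1"
  by (simp_all add: mpoly_const_def single_add mult_single)

lemma subfield_range_mpoly_const:
  "subfield (range mpoly_const) (mpoly_ring :: ('n::finite, 'k::field) mpoly ring)"
proof -
  interpret K: field "ring_of_type_algebra :: 'k ring"
    by (rule field_from_type_algebra)
  interpret R: ring "mpoly_ring :: ('n, 'k) mpoly ring"
    by (rule ring_mpoly_ring)
  have "ring_hom_ring ring_of_type_algebra (mpoly_ring :: ('n, 'k) mpoly ring) mpoly_const"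
    by (rule ring_hom_ringI) (simp_all add: K.ring_axioms R.ring_axioms,
        simp_all add: ring_of_type_algebra_def mpoly_const_simps)
  from ring_hom_ring.img_is_subfield(2)[OF this K.carrier_is_subfield]
  show ?thesis by (simp add: ring_of_type_algebra_def)
qed

lemma a_r_coset_eq_iff:
  assumes "ideal I (mpoly_ring :: ('n::finite, 'k::field) mpoly ring)"
  shows "I +>\<^bsub>mpoly_ring\<^esub> f = I +>\<^bsub>mpoly_ring\<^esub> g \<longleftrightarrow> f - g \<in> I"
proof -
  note sub = subspace_ideal[OF assms]
  have *: "I +>\<^bsub>mpoly_ring\<^esub> f = (\<lambda>i. i + f) ` I" for f
    by (auto simp: a_r_coset_def')
  show ?thesis
  proof
    assume "I +>\<^bsub>mpoly_ring\<^esub> f = I +>\<^bsub>mpoly_ring\<^esub> g"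
    moreover have "f \<in> (\<lambda>i. i + f) ` I"
      using polys.subspace_0[OF sub] by force
    ultimately obtain i where "i \<in> I" "f = i + g"
      unfolding * by auto
    then show "f - g \<in> I" by simp
  next
    assume fg: "f - g \<in> I"
    have "i + f \<in> (\<lambda>i. i + g) ` I" if "i \<in> I" for i
      using polys.subspace_add[OF sub that fg] by (intro image_eqI[of _ _ "i + (f - g)"]) auto
    moreover have "i + g \<in> (\<lambda>i. i + f) ` I" if "i \<in> I" for i
      using polys.subspace_diff[OF sub that fg] by (intro image_eqI[of _ _ "i - (f - g)"]) auto
    ultimately show "I +>\<^bsub>mpoly_ring\<^esub> f = I +>\<^bsub>mpoly_ring\<^esub> g"
      unfolding * by blast
  qed
qed

text \<open>This links \<open>ring.dim\<close>, built from line extensions over a subfield of a ring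
  record, to \<open>polys.dim\<close>. A basis \<open>A\<close> of \<open>I \<inter> V\<close> is
  extended to a basis \<open>B\<close> of \<open>V\<close>; the classes of \<open>B - A\<close> form
  a basis of the image. That \<open>1 \<notin> I\<close> makes the image of the field a
  subfield.\<close>

lemma dim_quotient_image:
  fixes I V :: "('n::finite, 'k::field) mpoly set"
  assumes I: "ideal I mpoly_ring" "1 \<notin> I"
    and V: "polys.subspace V" "V \<subseteq> polys.span T" "finite T"
  shows "ring.dim (mpoly_ring Quot I) ((\<lambda>f. I +>\<^bsub>mpoly_ring\<^esub> f) ` range mpoly_const)
      ((\<lambda>f. I +>\<^bsub>mpoly_ring\<^esub> f) ` V) + polys.dim (I \<inter> V) = polys.dim V"
proof -
  let ?p = "\<lambda>f. I +>\<^bsub>mpoly_ring\<^esub> f"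
  let ?S = "mpoly_ring Quot I"
  let ?K = "?p ` range mpoly_const"
  interpret h: ring_hom_ring mpoly_ring ?S ?p
    by (rule ideal.rcos_ring_hom_ring[OF I(1)])
  note eq = a_r_coset_eq_iff[OF I(1)]
  have zero: "?p 0 = \<zero>\<^bsub>?S\<^esub>"
    using h.hom_zero by simp
  have "\<one>\<^bsub>?S\<^esub> \<noteq> \<zero>\<^bsub>?S\<^esub>"
    using h.hom_one h.hom_zero eq[of 1 0] I(2) by simp
  then have K: "subfield ?K ?S"
    by (rule h.img_is_subfield(2)[OF subfield_range_mpoly_const])
  have U: "polys.subspace (I \<inter> V)"
    using V(1) subspace_ideal[OF I(1)] by (simp add: polys.subspace_inter)
  obtain A where A: "A \<subseteq> I \<inter> V" "polys.independent A" "I \<inter> V \<subseteq> polys.span A" "card A = polys.dim (I \<inter> V)"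
    by (rule polys.basis_exists[of "I \<inter> V"])
  then have "A \<subseteq> V" by blast
  from polys.maximal_independent_subset_extend[OF this A(2)]
  obtain B where B: "A \<subseteq> B" "B \<subseteq> V" "polys.independent B" "V \<subseteq> polys.span B"
    by metis
  have "finite B"
    using polys.independent_span_bound[OF V(3) B(3)] B(2) V(2) by blast
  have spA: "polys.span A = I \<inter> V"
    using A(1,3) U by (metis polys.span_subspace)
  have spB: "polys.span B = V"
    using B(2,4) V(1) by (metis polys.span_subspace)
  \<comment> \<open>Keeping \<open>A\<close> in the span changes nothing in the quotient; each new
    element of \<open>B - A\<close> is one line extension.\<close>
  have dim: "ring.dimension ?S (card D) ?K (?p ` polys.span (D \<union> A))" if "finite D" "D \<subseteq> B - A" for D
    using that
  proof (induction D)
    case empty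
    have "?p ` (I \<inter> V) = {?p 0}"
    proof -
      have "?p f = ?p 0" if "f \<in> I \<inter> V" for f
        using eq[of f 0] that by simp
      then have "?p ` (I \<inter> V) = (\<lambda>_. ?p 0) ` (I \<inter> V)"
        by (rule image_cong[OF refl])
      also have "\<dots> = {?p 0}"
        by (rule image_constant[OF polys.subspace_0[OF U]])
      finally show ?thesis .
    qed
    then show ?case
      using h.S.dimension.zero_dim[of ?K] by (simp add: spA zero)
  next
    case (insert d D)
    let ?W = "polys.span (D \<union> A)"
    have DA: "D \<union> A \<subseteq> B" and dB: "d \<in> B" and d: "d \<notin> D \<union> A"
      using insert B(1) by auto
    have W: "?W \<subseteq> V"
      using polys.span_mono[OF DA] spB by simp
    \<comment> \<open>Otherwise \<open>d\<close> is congruent modulo \<open>I\<close> to some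
      \<open>w\<close> in the span; then \<open>d - w\<close> lies in \<open>I \<inter> V\<close>,
      the span of \<open>A\<close>, and \<open>d\<close> depends on the rest of
      \<open>B\<close>.\<close>
    have "?p d \<notin> ?p ` ?W"
    proof
      assume "?p d \<in> ?p ` ?W"
      then obtain w where w: "w \<in> ?W" "d - w \<in> I"
        using eq by auto
      have "d - w \<in> V"
        using w(1) W dB B(2) V(1) by (intro polys.subspace_diff) auto
      then have "d - w \<in> polys.span A"
        using w spA by simp
      then have "d - w \<in> ?W"
        using polys.span_mono[of A "D \<union> A"] by auto
      then have "d - w + w \<in> ?W"
        using w(1) by (intro polys.span_add) auto
      moreover have "?W \<subseteq> polys.span (B - {d})"
        using DA d by (intro polys.span_mono) auto
      ultimately have "polys.dependent B"
        using dB by (auto simp: polys.dependent_def)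
      then show False using B(3) by simp
    qed
    moreover have "?p d \<in> carrier ?S"
      using h.hom_closed by simp
    moreover have "ring.dimension ?S (card D) ?K (?p ` ?W)"
      using insert by simp
    ultimately have "ring.dimension ?S (Suc (card D)) ?K (ring.line_extension ?S ?K (?p d) (?p ` ?W))"
      using h.S.dimension.Suc_dim by blast
    moreover have "ring.line_extension ?S ?K (?p d) (?p ` ?W) = ?p ` polys.span (insert d D \<union> A)"
    proof (intro equalityI subsetI)
      fix u assume "u \<in> ring.line_extension ?S ?K (?p d) (?p ` ?W)"
      then obtain a w where w: "w \<in> ?W" "u = ?p (mpoly_const a) \<otimes>\<^bsub>?S\<^esub> ?p d \<oplus>\<^bsub>?S\<^esub> ?p w"
        by (auto simp: h.S.line_extension_mem_iff)
      then have "u = ?p (poly_scale a d + w)"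
        using h.hom_mult[of "mpoly_const a" d] h.hom_add[of "mpoly_const a * d" w]
        by (simp add: poly_scale_def)
      moreover have "poly_scale a d + w \<in> polys.span (insert d D \<union> A)"
        using w(1) by (auto simp: polys.span_breakdown_eq intro: exI[of _ a])
      ultimately show "u \<in> ?p ` polys.span (insert d D \<union> A)" by blast
    next
      fix u assume "u \<in> ?p ` polys.span (insert d D \<union> A)"
      then obtain v a where v: "u = ?p v" "v - poly_scale a d \<in> ?W"
        by (auto simp: polys.span_breakdown_eq)
      have "u = ?p (mpoly_const a) \<otimes>\<^bsub>?S\<^esub> ?p d \<oplus>\<^bsub>?S\<^esub> ?p (v - poly_scale a d)"
        using h.hom_mult[of "mpoly_const a" d] h.hom_add[of "mpoly_const a * d" "v - poly_scale a d"] v(1)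
        by (simp add: poly_scale_def)
      then show "u \<in> ring.line_extension ?S ?K (?p d) (?p ` ?W)"
        using v(2) unfolding h.S.line_extension_mem_iff by blast
    qed
    ultimately show ?case
      using insert by simp
  qed
  have fin: "finite (B - A)"
    using \<open>finite B\<close> by simp
  have "ring.dimension ?S (card (B - A)) ?K (?p ` V)"
    using dim[OF fin subset_refl] B(1) spB by (simp add: Un_absorb2)
  then have "ring.dim ?S ?K (?p ` V) = card (B - A)"
    using h.S.dimI[OF K] unfolding over_def by blast
  moreover have "polys.dim V = card B"
    using B by (metis polys.dim_unique)
  moreover have "card (B - A) + card A = card B"
    using \<open>finite B\<close> B(1) by (metis card_Diff_subset card_mono finite_subset le_add_diff_inverse2)
  ultimately show ?thesis using A(4) by simp
qed

section \<open>The filtration by total degree\<close>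

lemma homogeneous_component_eq:
  "homogeneous_component m = supported_polys {\<mu>. int (monomial_degree \<mu>) = m}"
  by (auto simp: homogeneous_component_def supported_polys_def)

definition polys_le :: "nat \<Rightarrow> ('n::finite, 'k::field) mpoly set"
  where "polys_le m = supported_polys {\<mu>. monomial_degree \<mu> \<le> m}"

lemma subspace_polys_le: "polys.subspace (polys_le m)"
  unfolding polys_le_def by (rule subspace_supported_polys)

lemma polys_le_finite_span: "\<exists>T. finite T \<and> (polys_le m :: ('n::finite, 'k::field) mpoly set) \<subseteq> polys.span T"
  unfolding polys_le_def using supported_polys_dim(2)[OF finite_monomials_degree_le[of m]]
  by (metis finite_imageI finite_monomials_degree_le)

lemma polys_le_mono: "m \<le> m' \<Longrightarrow> polys_le m \<subseteq> polys_le m'"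
  by (auto simp: polys_le_def supported_polys_def)

lemma monomial_degree_add: "monomial_degree (\<mu> + \<nu>) = monomial_degree \<mu> + monomial_degree \<nu>"
  by (simp add: monomial_degree_def lookup_add sum.distrib)

lemma polys_le_mult:
  assumes "f \<in> polys_le m" "g \<in> polys_le p"
  shows "f * g \<in> polys_le (m + p)"
proof -
  have "monomial_degree \<mu> \<le> m + p" if \<mu>: "\<mu> \<in> Poly_Mapping.keys (f * g)" for \<mu>
  proof -
    obtain \<nu> \<eta> where "\<mu> = \<nu> + \<eta>" "\<nu> \<in> Poly_Mapping.keys f" "\<eta> \<in> Poly_Mapping.keys g"
      using \<mu> keys_mult[of f g] by blast
    moreover from this have "monomial_degree \<nu> \<le> m" "monomial_degree \<eta> \<le> p"
      using assms by (auto simp: polys_le_def supported_polys_def)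
    ultimately show ?thesis
      by (simp add: monomial_degree_add)
  qed
  then show ?thesis by (auto simp: polys_le_def supported_polys_def)
qed

lemma exists_polys_le: "\<exists>m. f \<in> polys_le m"
proof -
  have "f \<in> polys_le (Max (insert 0 (monomial_degree ` Poly_Mapping.keys f)))"
    by (auto simp: polys_le_def supported_polys_def intro!: Max_ge)
  then show ?thesis ..
qed

lemma one_in_polys_le: "1 \<in> polys_le m"
  by (simp add: polys_le_def supported_polys_def monomial_degree_def)

lemma hilbert_function_plus_dim:
  fixes I :: "('n::finite, 'k::field) mpoly set"
  assumes "ideal I mpoly_ring" "1 \<notin> I"
  shows "hilbert_function I m + polys.dim (I \<inter> homogeneous_component (int m)) =
    polys.dim (homogeneous_component (int m) :: ('n, 'k) mpoly set)"
proof -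
  have *: "(homogeneous_component (int m) :: ('n, 'k) mpoly set) = supported_polys {\<mu>. monomial_degree \<mu> = m}"
    by (simp add: homogeneous_component_eq)
  show ?thesis
    unfolding hilbert_function_def *
    by (rule dim_quotient_image[OF assms subspace_supported_polys
          supported_polys_dim(2)[OF finite_monomials_degree_eq] finite_imageI[OF finite_monomials_degree_eq]])
qed

section \<open>The affine Hilbert function\<close>

text \<open>The dimension of \<open>polys_le m\<close> modulo \<open>J\<close>; the next lemma shows
  that the subtraction is not truncated.\<close>

definition affine_hilbert :: "('n::finite, 'k::field) mpoly set \<Rightarrow> nat \<Rightarrow> nat"
  where "affine_hilbert J m = polys.dim (polys_le m :: ('n, 'k) mpoly set) - polys.dim (J \<inter> polys_le m)"

lemma affine_hilbert_plus_dim: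
  fixes J :: "('n::finite, 'k::field) mpoly set"
  shows "affine_hilbert J m + polys.dim (J \<inter> polys_le m) = polys.dim (polys_le m :: ('n, 'k) mpoly set)"
proof -
  obtain T :: "('n, 'k) mpoly set" where T: "finite T" "polys_le m \<subseteq> polys.span T"
    using polys_le_finite_span by blast
  have "polys.dim (J \<inter> polys_le m) \<le> polys.dim (polys_le m :: ('n, 'k) mpoly set)"
    by (rule polys.dim_mono_finite[OF _ T(2,1)]) simp
  then show ?thesis by (simp add: affine_hilbert_def)
qed

lemma affine_hilbert_antimono:
  fixes J J' :: "('n::finite, 'k::field) mpoly set"
  assumes "J \<subseteq> J'"
  shows "affine_hilbert J' m \<le> affine_hilbert J m"
proof -
  obtain T :: "('n, 'k) mpoly set" where T: "finite T" "polys_le m \<subseteq> polys.span T"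
    using polys_le_finite_span by blast
  have "polys.dim (J \<inter> polys_le m) \<le> polys.dim (J' \<inter> polys_le m)"
    using assms T by (intro polys.dim_mono_finite[OF _ _ T(1)]) auto
  then show ?thesis by (simp add: affine_hilbert_def)
qed


text \<open>The inclusion of \<open>polys_le m\<close> in \<open>polys_le m'\<close> stays injective
  modulo \<open>J\<close>.\<close>

lemma affine_hilbert_mono:
  fixes J :: "('n::finite, 'k::field) mpoly set"
  assumes J: "polys.subspace J" and m: "m \<le> m'"
  shows "affine_hilbert J m \<le> affine_hilbert J m'"
proof -
  obtain T T' :: "('n, 'k) mpoly set"
    where T: "finite T" "polys_le m \<subseteq> polys.span T" "finite T'" "polys_le m' \<subseteq> polys.span T'"
    using polys_le_finite_span by metis
  have "polys.dim (polys_le m :: ('n, 'k) mpoly set) + polys.dim (J \<inter> polys_le m') \<le>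
      polys.dim (polys_le m' :: ('n, 'k) mpoly set) + polys.dim (J \<inter> polys_le m)"
    using J polys_le_mono[OF m]
    by (intro polys.codim_le[where f = id and S = T' and T = T])
      (auto intro!: T polys.subspace_inter subspace_polys_le polys.linear_id)
  then show ?thesis
    using affine_hilbert_plus_dim[of J m] affine_hilbert_plus_dim[of J m'] by linarith
qed

text \<open>The line of constants meets \<open>J\<close> only in zero, so it embeds into the
  quotient.\<close>

lemma affine_hilbert_pos:
  fixes J :: "('n::finite, 'k::field) mpoly set"
  assumes J: "polys.subspace J" "1 \<notin> J"
  shows "0 < affine_hilbert J m"
proof -
  obtain T :: "('n, 'k) mpoly set" where T: "finite T" "polys_le m \<subseteq> polys.span T"
    using polys_le_finite_span by metis
  have "polys.dim (polys.span {1 :: ('n, 'k) mpoly}) + polys.dim (J \<inter> polys_le m) \<le>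
      polys.dim (polys_le m :: ('n, 'k) mpoly set) + polys.dim ({0} :: ('n, 'k) mpoly set)"
  proof (rule polys.codim_le[where f = id and S = T and T = "{1}"])
    show "id ` polys.span {1} \<subseteq> (polys_le m :: ('n, 'k) mpoly set)"
      by (simp add: polys.span_minimal one_in_polys_le subspace_polys_le)
    fix v :: "('n, 'k) mpoly" assume "v \<in> polys.span {1}" "id v \<in> J \<inter> polys_le m"
    then obtain a where a: "v = poly_scale a 1" "v \<in> J"
      by (auto simp: polys.span_singleton)
    have "a = 0"
    proof (rule ccontr)
      assume "a \<noteq> 0"
      then have "1 = poly_scale (inverse a) v" using a by simp
      then show False using J a(2) polys.subspace_scale by metis
    qed
    then show "v \<in> {0}" using a by simp
  qed (use J T in \<open>auto intro!: polys.subspace_inter subspace_polys_le polys.linear_id polys.span_zero\<close>)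
  moreover have "polys.dim (polys.span {1 :: ('n, 'k) mpoly}) = 1"
    by (subst polys.dim_span_eq_card_independent) auto
  moreover have "polys.dim ({0} :: ('n, 'k) mpoly set) = 0"
    by (rule polys.dim_unique[of "{}"]) (simp_all add: polys.independent_empty)
  ultimately show ?thesis
    using affine_hilbert_plus_dim[of J m] by linarith
qed

text \<open>Multiplication by \<open>x\<close> embeds \<open>R/J\<close> into \<open>J'/J\<close>.\<close>

lemma affine_hilbert_nonzerodivisor:
  fixes J J' :: "('n::finite, 'k::field) mpoly set"
  assumes J: "polys.subspace J" and J': "ideal J' mpoly_ring" and sub: "J \<subseteq> J'" and x: "x \<in> J'" "x \<in> polys_le e"
    and reg: "\<And>f. x * f \<in> J \<Longrightarrow> f \<in> J"
  shows "affine_hilbert J' (m + e) + affine_hilbert J m \<le> affine_hilbert J (m + e)"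
proof -
  obtain T T' :: "('n, 'k) mpoly set"
    where T: "finite T" "polys_le m \<subseteq> polys.span T" "finite T'" "polys_le (m + e) \<subseteq> polys.span T'"
    using polys_le_finite_span by metis
  have lin: "Vector_Spaces.linear poly_scale poly_scale ((*) x)"
    by (simp add: Vector_Spaces.linear_iff polys.vector_space_axioms poly_scale_def algebra_simps)
  have "x * f \<in> J' \<inter> polys_le (m + e)" if "f \<in> polys_le m" for f
    using polys_le_mult[OF x(2) that] mpoly_ideal_closed(3)[OF J' x(1), of f]
    by (simp add: add.commute mult.commute)
  \<comment> \<open>The quotient of \<open>J' \<inter> polys_le (m + e)\<close> by
    \<open>J \<inter> polys_le (m + e)\<close> has dimension
    \<open>affine_hilbert J (m + e) - affine_hilbert J' (m + e)\<close>.\<close>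
  then have "polys.dim (polys_le m :: ('n, 'k) mpoly set) + polys.dim (J \<inter> polys_le (m + e)) \<le>
      polys.dim (J' \<inter> polys_le (m + e)) + polys.dim (J \<inter> polys_le m)"
    using J sub reg T subspace_ideal[OF J']
    by (intro polys.codim_le[where f = "(*) x" and S = T' and T = T])
      (auto intro!: polys.subspace_inter subspace_polys_le lin)
  then show ?thesis
    using affine_hilbert_plus_dim[of J m] affine_hilbert_plus_dim[of J "m + e"]
      affine_hilbert_plus_dim[of J' "m + e"] by linarith
qed

text \<open>Each regular element lowers the order of growth by one. The bound is multiplied out,
  since \<open>i\<close> is not yet known to be at most \<open>CARD('n)\<close> and
  \<open>CARD('n) - i\<close> could be truncated.\<close>

lemma regular_sequence_growth:
  fixes xs :: "('n::finite, 'k::field) mpoly list"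
  assumes xs: "regular_sequence mpoly_ring xs" and i: "i \<le> length xs"
  shows "\<exists>C. \<forall>m. (m + 1) ^ i * affine_hilbert (Idl\<^bsub>mpoly_ring\<^esub> (set (take i xs))) m \<le> C * (m + 1) ^ CARD('n)"
  using i
proof (induction i)
  case 0
  have "affine_hilbert (Idl\<^bsub>mpoly_ring\<^esub> (set (take 0 xs))) m \<le> (m + 1) ^ CARD('n)" for m
  proof -
    have "affine_hilbert (Idl\<^bsub>mpoly_ring\<^esub> (set (take 0 xs))) m \<le> polys.dim (polys_le m :: ('n, 'k) mpoly set)"
      by (simp add: affine_hilbert_def)
    also have "\<dots> \<le> (m + 1) ^ CARD('n)"
      unfolding polys_le_def supported_polys_dim(1)[OF finite_monomials_degree_le]
      by (rule card_monomials_degree_le)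
    finally show ?thesis .
  qed
  then show ?case by (intro exI[of _ 1]) simp
next
  case (Suc i)
  interpret R: ring "mpoly_ring :: ('n, 'k) mpoly ring"
    by (rule ring_mpoly_ring)
  define J where "J = Idl\<^bsub>mpoly_ring\<^esub> (set (take i xs))"
  define J' where "J' = Idl\<^bsub>mpoly_ring\<^esub> (set (take (Suc i) xs))"
  define x where "x = xs ! i"
  have lt: "i < length xs" using Suc.prems by simp
  have idJ: "ideal J mpoly_ring" "ideal J' mpoly_ring"
    unfolding J_def J'_def by (rule R.genideal_ideal; simp)+
  have gen: "set (take (Suc i) xs) \<subseteq> J'"
    unfolding J'_def by (rule R.genideal_self) simp
  have JJ': "J \<subseteq> J'"
    unfolding J_def using gen by (intro R.genideal_minimal idJ) (auto dest: in_set_takeD simp: take_Suc_conv_app_nth[OF lt])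
  have xJ': "x \<in> J'"
    using gen by (auto simp: take_Suc_conv_app_nth[OF lt] x_def)
  have reg: "f \<in> J" if "x * f \<in> J" for f
    using xs lt that unfolding regular_sequence_def J_def x_def by simp
  obtain e where e: "x \<in> polys_le e" using exists_polys_le by blast
  have step: "affine_hilbert J' (m + e) + affine_hilbert J m \<le> affine_hilbert J (m + e)" for m
    by (rule affine_hilbert_nonzerodivisor[OF subspace_ideal[OF idJ(1)] idJ(2) JJ' xJ' e reg])
  \<comment> \<open>Telescoping along \<open>m\<close>, \<open>m + e\<close>,
    \<open>m + 2 * e\<close>, and so on: each step gains at least
    \<open>affine_hilbert J' m\<close>.\<close>
  have iter: "q * affine_hilbert J' m \<le> affine_hilbert J (m + q * e)" for q m
  proof (induction q)
    case (Suc q)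
    have "affine_hilbert J' m \<le> affine_hilbert J' (m + q * e + e)"
      by (rule affine_hilbert_mono[OF subspace_ideal[OF idJ(2)]]) simp
    with Suc step[of "m + q * e"] show ?case by (simp add: algebra_simps)
  qed simp
  obtain C where C: "\<And>m. (m + 1) ^ i * affine_hilbert J m \<le> C * (m + 1) ^ CARD('n)"
    using Suc unfolding J_def by auto
  have "(m + 1) ^ Suc i * affine_hilbert J' m \<le> C * (e + 1) ^ CARD('n) * (m + 1) ^ CARD('n)" for m
  proof -
    \<comment> \<open>The end point of \<open>m + 1\<close> steps. Since \<open>M + 1\<close> is
      \<open>(e + 1) * (m + 1)\<close>, the bound at \<open>M\<close> costs only a constant factor,
      while the steps gain the factor \<open>m + 1\<close>.\<close>
    define M where "M = m + (m + 1) * e"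
    have M: "M + 1 = (e + 1) * (m + 1)" by (simp add: M_def algebra_simps)
    have "(m + 1) ^ Suc i * affine_hilbert J' m = (m + 1) ^ i * ((m + 1) * affine_hilbert J' m)"
      by (simp only: power_Suc2 mult.assoc)
    also have "\<dots> \<le> (M + 1) ^ i * affine_hilbert J M"
      using iter[of "m + 1" m] by (intro mult_mono power_mono) (auto simp: M_def)
    also have "\<dots> \<le> C * (M + 1) ^ CARD('n)" by (rule C)
    also have "\<dots> = C * (e + 1) ^ CARD('n) * (m + 1) ^ CARD('n)"
      unfolding M power_mult_distrib by simp
    finally show ?thesis .
  qed
  then show ?case unfolding J'_def by blast
qed

text \<open>If all regular sequences in \<open>I\<close> were shorter than \<open>s\<close>, their
  supremum would be at most \<open>s - 1\<close>, which is less than \<open>s\<close> as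
  \<open>s \<ge> 1\<close>. A longer sequence is cut to its first \<open>s\<close> elements, and
  passing to the larger ideal \<open>I\<close> only lowers the affine Hilbert function.\<close>

lemma affine_hilbert_growth:
  fixes I :: "('n::finite, 'k::field) mpoly set"
  assumes I: "ideal I mpoly_ring" and gr: "grade mpoly_ring I = enat s" and s: "s \<ge> 1"
  shows "\<exists>C. \<forall>m. (m + 1) ^ s * affine_hilbert I m \<le> C * (m + 1) ^ CARD('n)"
proof -
  interpret R: ring "mpoly_ring :: ('n, 'k) mpoly ring"
    by (rule ring_mpoly_ring)
  have "\<exists>xs. regular_sequence mpoly_ring xs \<and> set xs \<subseteq> I \<and> s \<le> length xs"
  proof (rule ccontr)
    assume *: "\<not> ?thesis"
    have "grade mpoly_ring I \<le> enat (s - 1)"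
      unfolding grade_def
    proof (rule SUP_least)
      fix xs assume "xs \<in> {xs. regular_sequence mpoly_ring xs \<and> set xs \<subseteq> I}"
      with * have "length xs < s" by force
      then show "enat (length xs) \<le> enat (s - 1)" by simp
    qed
    with gr s show False by simp
  qed
  then obtain xs where xs: "regular_sequence mpoly_ring xs" "set xs \<subseteq> I" "s \<le> length xs"
    by blast
  obtain C where C: "\<And>m. (m + 1) ^ s * affine_hilbert (Idl\<^bsub>mpoly_ring\<^esub> (set (take s xs))) m \<le> C * (m + 1) ^ CARD('n)"
    using regular_sequence_growth[OF xs(1,3)] by blast
  have "Idl\<^bsub>mpoly_ring\<^esub> (set (take s xs)) \<subseteq> I"
    using xs(2) by (intro R.genideal_minimal I) (auto dest: in_set_takeD)
  from affine_hilbert_antimono[OF this]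
  have "(m + 1) ^ s * affine_hilbert I m \<le> C * (m + 1) ^ CARD('n)" for m
    using C[of m] by (meson le_trans mult_le_mono2)
  then show ?thesis by blast
qed

text \<open>For \<open>s > CARD('n)\<close> the growth bound fails already at \<open>m = C\<close>,
  because the affine Hilbert function is positive. Thus \<open>CARD('n) - s\<close> is a genuine
  difference.\<close>

lemma grade_le_card:
  fixes I :: "('n::finite, 'k::field) mpoly set"
  assumes I: "ideal I mpoly_ring" "1 \<notin> I" and gr: "grade mpoly_ring I = enat s" and s: "s \<ge> 1"
  shows "s \<le> CARD('n)"
proof (rule ccontr)
  assume "\<not> ?thesis"
  then have less: "Suc CARD('n) \<le> s" by simp
  obtain C where C: "\<And>m. (m + 1) ^ s * affine_hilbert I m \<le> C * (m + 1) ^ CARD('n)"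
    using affine_hilbert_growth[OF I(1) gr s] by blast
  have "(C + 1) * (C + 1) ^ CARD('n) \<le> (C + 1) ^ s"
    using power_increasing[OF less, of "C + 1"] by simp
  also have "\<dots> \<le> (C + 1) ^ s * affine_hilbert I C"
    using affine_hilbert_pos[OF subspace_ideal[OF I(1)] I(2), of C] by simp
  also have "\<dots> \<le> C * (C + 1) ^ CARD('n)" by (rule C)
  finally show False by simp
qed

section \<open>Homogeneous parts and partial sums of the Hilbert function\<close>

definition homogeneous_part :: "int \<Rightarrow> ('n::finite, 'k::field) mpoly \<Rightarrow> ('n, 'k) mpoly"
  where "homogeneous_part m f = Poly_Mapping.mapp (\<lambda>\<mu> a. a when int (monomial_degree \<mu>) = m) f"

lemma lookup_homogeneous_part [simp]:
  "Poly_Mapping.lookup (homogeneous_part m f) \<mu> =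
    (Poly_Mapping.lookup f \<mu> when int (monomial_degree \<mu>) = m)"
  by (simp add: homogeneous_part_def lookup_mapp when_def in_keys_iff)

lemma linear_homogeneous_part: "Vector_Spaces.linear poly_scale poly_scale (homogeneous_part m)"
  by (auto simp: Vector_Spaces.linear_iff polys.vector_space_axioms lookup_add when_def
      intro!: poly_mapping_eqI)

lemma homogeneous_part_in_component: "homogeneous_part m f \<in> homogeneous_component m"
  by (auto simp: homogeneous_component_eq supported_polys_iff)

lemma homogeneous_part_component:
  "f \<in> homogeneous_component p \<Longrightarrow> homogeneous_part m f = (if m = p then f else 0)"
  by (auto simp: homogeneous_component_eq supported_polys_iff when_def intro!: poly_mapping_eqI)

text \<open>Rank-nullity for the part of degree \<open>Suc m\<close>: its kernel consists of the
  elements of degree at most \<open>m\<close>, and closure under parts makes the graded piece its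
  image.\<close>

lemma dim_polys_le_Suc:
  fixes J :: "('n::finite, 'k::field) mpoly set"
  assumes J: "polys.subspace J" and hom: "\<And>f m. f \<in> J \<Longrightarrow> homogeneous_part m f \<in> J"
  shows "polys.dim (J \<inter> polys_le (Suc m)) =
    polys.dim (J \<inter> polys_le m) + polys.dim (J \<inter> homogeneous_component (int (Suc m)))"
proof -
  let ?h = "homogeneous_part (int (Suc m)) :: ('n, 'k) mpoly \<Rightarrow> _"
  obtain T :: "('n, 'k) mpoly set" where T: "finite T" "polys_le (Suc m) \<subseteq> polys.span T"
    using polys_le_finite_span by blast
  have "polys.dim (J \<inter> polys_le (Suc m)) = polys.dim {f \<in> J \<inter> polys_le (Suc m). ?h f = 0} +
      polys.dim (?h ` (J \<inter> polys_le (Suc m)))"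
    by (rule polys_polys.dim_eq_dim_kernel_plus_dim_image[OF linear_homogeneous_part _ _ T(1)])
      (use J T in \<open>auto intro!: polys.subspace_inter subspace_polys_le\<close>)
  also have "{f \<in> J \<inter> polys_le (Suc m). ?h f = 0} = J \<inter> polys_le m"
  proof -
    have "f \<in> polys_le m \<longleftrightarrow> f \<in> polys_le (Suc m) \<and> ?h f = 0" for f
      by (auto simp: polys_le_def supported_polys_iff poly_mapping_eq_iff fun_eq_iff when_def not_le le_Suc_eq)
    then show ?thesis by auto
  qed
  also have "?h ` (J \<inter> polys_le (Suc m)) = J \<inter> homogeneous_component (int (Suc m))"
  proof (intro equalityI subsetI)
    fix f :: "('n, 'k) mpoly" assume f: "f \<in> J \<inter> homogeneous_component (int (Suc m))"
    then have "f \<in> polys_le (Suc m)"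
      by (auto simp: polys_le_def homogeneous_component_eq supported_polys_def)
    moreover have "f = ?h f"
      using f homogeneous_part_component[of f "int (Suc m)" "int (Suc m)"] by simp
    ultimately show "f \<in> ?h ` (J \<inter> polys_le (Suc m))"
      using f by blast
  qed (use hom homogeneous_part_in_component in auto)
  finally show ?thesis .
qed

text \<open>This carries the growth bound, obtained from non-homogeneous elements, over to the
  graded Hilbert function.\<close>

lemma affine_hilbert_eq_sum:
  fixes I :: "('n::finite, 'k::field) mpoly set"
  assumes I: "ideal I mpoly_ring" "1 \<notin> I" and hom: "\<And>f m. f \<in> I \<Longrightarrow> homogeneous_part m f \<in> I"
  shows "affine_hilbert I m = (\<Sum>i\<le>m. hilbert_function I i)"
proof (induction m)
  case 0
  have "(polys_le 0 :: ('n, 'k) mpoly set) = homogeneous_component (int 0)"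
    by (auto simp: polys_le_def homogeneous_component_eq)
  then show ?case
    using affine_hilbert_plus_dim[of I 0] hilbert_function_plus_dim[OF I, of 0] by simp
next
  case (Suc m)
  \<comment> \<open>The dimension formula is used for \<open>I\<close> and for the whole ring; their
    difference is the new value of the Hilbert function.\<close>
  then show ?case
    using dim_polys_le_Suc[OF subspace_ideal[OF I(1)] hom, of m]
      dim_polys_le_Suc[of "UNIV :: ('n, 'k) mpoly set" m]
      affine_hilbert_plus_dim[of I m] affine_hilbert_plus_dim[of I "Suc m"]
      hilbert_function_plus_dim[OF I, of "Suc m"] by simp
qed

text \<open>Polynomials without constant term form an ideal that contains the variables.\<close>

lemma lookup_zero_irrelevant_ideal:
  assumes "f \<in> (irrelevant_ideal :: ('n::finite, 'k::field) mpoly set)"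
  shows "Poly_Mapping.lookup f 0 = 0"
proof -
  interpret R: ring "mpoly_ring :: ('n, 'k) mpoly ring"
    by (rule ring_mpoly_ring)
  let ?Z = "{f :: ('n, 'k) mpoly. Poly_Mapping.lookup f 0 = 0}"
  have mult: "f * g \<in> ?Z" if "g \<in> ?Z" for f g
  proof (rule ccontr)
    assume "f * g \<notin> ?Z"
    then have "0 \<in> Poly_Mapping.keys (f * g)" by (simp add: in_keys_iff)
    then obtain \<nu> \<eta> where *: "0 = \<nu> + \<eta>" "\<eta> \<in> Poly_Mapping.keys g"
      using keys_mult[of f g] by blast
    have "Poly_Mapping.lookup \<nu> i + Poly_Mapping.lookup \<eta> i = 0" for i
      using *(1) by (metis lookup_add lookup_zero)
    then have "\<eta> = 0" by (intro poly_mapping_eqI) simp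
    then show False using *(2) that by (simp add: in_keys_iff)
  qed
  have "ideal ?Z mpoly_ring"
  proof (rule idealI[OF ring_mpoly_ring])
    show "subgroup ?Z (add_monoid (mpoly_ring :: ('n, 'k) mpoly ring))"
    proof (rule R.add.subgroupI)
      fix f :: "('n, 'k) mpoly" assume f: "f \<in> ?Z"
      have "\<ominus>\<^bsub>mpoly_ring\<^esub> f = - f"
        by (rule R.add.inv_equality) simp_all
      then show "\<ominus>\<^bsub>mpoly_ring\<^esub> f \<in> ?Z" using f by simp
    qed (auto simp: lookup_add intro: exI[of _ 0])
  qed (use mult in \<open>auto simp: mult.commute\<close>)
  moreover have "range mpoly_var \<subseteq> ?Z"
  proof -
    have "Poly_Mapping.single i (1 :: nat) \<noteq> 0" for i :: 'n
      by (metis lookup_single_eq lookup_zero one_neq_zero)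
    then show ?thesis
      by (auto simp: mpoly_var_def lookup_single when_def)
  qed
  ultimately have "irrelevant_ideal \<subseteq> ?Z"
    unfolding irrelevant_ideal_def by (rule R.genideal_minimal)
  with assms show ?thesis by blast
qed

lemma one_notin_irrelevant_ideal: "1 \<notin> (irrelevant_ideal :: ('n::finite, 'k::field) mpoly set)"
  using lookup_zero_irrelevant_ideal[of "1 :: ('n, 'k) mpoly"] by auto

section \<open>The Hilbert series from a graded resolution\<close>

text \<open>The index set of the monomial basis in degree \<open>m\<close>; a negative
  \<open>m - d ! j\<close> admits no monomial.\<close>

definition component_support :: "int list \<Rightarrow> int \<Rightarrow> (nat \<times> ('n::finite \<Rightarrow>\<^sub>0 nat)) set"
  where "component_support d m = (SIGMA j:{..<length d}. {\<mu>. int (monomial_degree \<mu>) = m - d ! j})"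

lemma finite_monomials_int_degree: "finite {\<mu> :: 'n::finite \<Rightarrow>\<^sub>0 nat. int (monomial_degree \<mu>) = m}"
  by (rule finite_subset[OF _ finite_monomials_degree_eq[of "nat m"]]) auto

lemma finite_component_support: "finite (component_support d m)"
  unfolding component_support_def by (intro finite_SigmaI finite_monomials_int_degree) simp

lemma card_component_support:
  "card (component_support d m :: (nat \<times> ('n::finite \<Rightarrow>\<^sub>0 nat)) set) =
    (\<Sum>j<length d. card {\<mu> :: 'n \<Rightarrow>\<^sub>0 nat. int (monomial_degree \<mu>) = m - d ! j})"
  unfolding component_support_def by (rule card_SigmaI) (simp_all add: finite_monomials_int_degree)

lemma free_module_component_eq:
  "(free_module_component d m :: (nat \<Rightarrow> ('n::finite, 'k::field) mpoly) set) =
    supported_vecs (component_support d m)"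
proof (intro equalityI subsetI)
  fix v :: "nat \<Rightarrow> ('n, 'k) mpoly"
  assume v: "v \<in> free_module_component d m"
  have "Poly_Mapping.lookup (v j) \<mu> = 0" if "(j, \<mu>) \<notin> component_support d m" for j \<mu>
    using v that by (cases "j < length d")
      (auto simp: free_module_component_def free_module_def component_support_def
        homogeneous_component_eq supported_polys_iff)
  then show "v \<in> supported_vecs (component_support d m)"
    by (simp add: supported_vecs_iff)
next
  fix v :: "nat \<Rightarrow> ('n, 'k) mpoly"
  assume "v \<in> supported_vecs (component_support d m)"
  then have v: "Poly_Mapping.lookup (v j) \<mu> = 0" if "(j, \<mu>) \<notin> component_support d m" for j \<mu>
    using that by (simp add: supported_vecs_iff)
  then have "v j = 0" if "j \<ge> length d" for j
    using that by (intro poly_mapping_eqI) (auto simp: component_support_def)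
  moreover have "v j \<in> homogeneous_component (m - d ! j)" for j
    using v by (auto simp: component_support_def homogeneous_component_eq supported_polys_iff)
  ultimately show "v \<in> free_module_component d m"
    by (simp add: free_module_component_def free_module_def)
qed

lemma subspace_free_module_component: "vecs.subspace (free_module_component d m)"
  unfolding free_module_component_eq by (rule subspace_supported_vecs)

lemma free_module_component_finite_span:
  "\<exists>T. finite T \<and> (free_module_component d m :: (nat \<Rightarrow> ('n::finite, 'k::field) mpoly) set) \<subseteq> vecs.span T"
  unfolding free_module_component_eq
  by (rule exI, rule conjI[rotated], rule supported_vecs_dim(2)[OF finite_component_support])
    (simp add: finite_component_support)

lemma dim_free_module_component:
  "vecs.dim (free_module_component d m :: (nat \<Rightarrow> ('n::finite, 'k::field) mpoly) set) =
    (\<Sum>j<length d. card {\<mu> :: 'n \<Rightarrow>\<^sub>0 nat. int (monomial_degree \<mu>) = m - d ! j})"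
  unfolding free_module_component_eq supported_vecs_dim(1)[OF finite_component_support]
  by (rule card_component_support)

lemma free_module_component_carrier: "free_module_component d m \<subseteq> carrier (free_module d)"
  by (simp add: free_module_component_def)

section \<open>Homogeneous parts of vectors and graded maps\<close>

definition truncate_vec :: "int list \<Rightarrow> (nat \<Rightarrow> ('n::finite, 'k::field) mpoly) \<Rightarrow> nat \<Rightarrow> ('n, 'k) mpoly"
  where "truncate_vec d v = (\<lambda>j. if j < length d then v j else 0)"

lemma truncate_carrier: "truncate_vec d v \<in> carrier (free_module d)"
  by (simp add: truncate_vec_def free_module_def)

lemma truncate_id: "v \<in> carrier (free_module d) \<Longrightarrow> truncate_vec d v = v"
  by (auto simp: truncate_vec_def free_module_def)

lemma truncate_component: "v \<in> free_module_component d m \<Longrightarrow> truncate_vec d v = v"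
  by (rule truncate_id) (simp add: free_module_component_def)

text \<open>A module homomorphism is unconstrained outside the carrier; precomposing with the truncation
  makes it linear on the whole type.\<close>

lemma linear_module_hom_truncate:
  fixes f :: "(nat \<Rightarrow> ('n::finite, 'k::field) mpoly) \<Rightarrow> nat \<Rightarrow> ('n, 'k) mpoly"
  assumes "f \<in> module_hom mpoly_ring (free_module d) (free_module d')"
  shows "Vector_Spaces.linear vec_scale vec_scale (\<lambda>v. f (truncate_vec d v))"
  unfolding Vector_Spaces.linear_iff
proof (intro conjI allI vecs.vector_space_axioms)
  fix v w :: "nat \<Rightarrow> ('n, 'k) mpoly" and a :: 'k
  have add: "f (v \<oplus>\<^bsub>free_module d\<^esub> w) = f v \<oplus>\<^bsub>free_module d'\<^esub> f w"
    if "v \<in> carrier (free_module d)" "w \<in> carrier (free_module d)" for v w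
    using assms that by (simp add: module_hom_def)
  have smult: "f (g \<odot>\<^bsub>free_module d\<^esub> v) = g \<odot>\<^bsub>free_module d'\<^esub> f v"
    if "v \<in> carrier (free_module d)" for v g
    using assms that by (simp add: module_hom_def)
  have "truncate_vec d (v + w) = truncate_vec d v \<oplus>\<^bsub>free_module d\<^esub> truncate_vec d w"
    by (auto simp: truncate_vec_def free_module_def)
  then show "f (truncate_vec d (v + w)) = f (truncate_vec d v) + f (truncate_vec d w)"
    using add[OF truncate_carrier truncate_carrier, of v w] by (auto simp: free_module_def)
  have "truncate_vec d (vec_scale a v) = mpoly_const a \<odot>\<^bsub>free_module d\<^esub> truncate_vec d v"
    by (auto simp: truncate_vec_def free_module_def vec_scale_def)
  then show "f (truncate_vec d (vec_scale a v)) = vec_scale a (f (truncate_vec d v))"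
    using smult[OF truncate_carrier, of "mpoly_const a" v] by (auto simp: free_module_def vec_scale_def)
qed

definition vec_part :: "int list \<Rightarrow> int \<Rightarrow> (nat \<Rightarrow> ('n::finite, 'k::field) mpoly) \<Rightarrow> nat \<Rightarrow> ('n, 'k) mpoly"
  where "vec_part d m v = (\<lambda>j. if j < length d then homogeneous_part (m - d ! j) (v j) else 0)"

lemma vec_part_in_component: "vec_part d m v \<in> free_module_component d m"
  by (simp add: vec_part_def free_module_component_def free_module_def homogeneous_part_in_component)

lemma vec_part_component:
  "v \<in> free_module_component d p \<Longrightarrow> vec_part d m v = (if m = p then v else 0)"
  by (auto simp: vec_part_def free_module_component_def free_module_def fun_eq_iff
      homogeneous_part_component)

lemma linear_vec_part: "Vector_Spaces.linear vec_scale vec_scale (vec_part d m)"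
  by (auto simp: Vector_Spaces.linear_iff vecs.vector_space_axioms vec_part_def fun_eq_iff
      lookup_add when_def intro!: poly_mapping_eqI)

lemma vec_part_sum:
  assumes "v \<in> carrier (free_module d)"
  shows "\<exists>P. finite P \<and> v = (\<Sum>p\<in>P. vec_part d p v) \<and> (\<forall>p. p \<notin> P \<longrightarrow> vec_part d p v = 0)"
proof -
  define P where "P = (\<Union>j<length d. (\<lambda>\<mu>. int (monomial_degree \<mu>) + d ! j) ` Poly_Mapping.keys (v j))"
  have fin: "finite P" unfolding P_def by simp
  have P: "int (monomial_degree \<mu>) + d ! j \<in> P"
    if "j < length d" "Poly_Mapping.lookup (v j) \<mu> \<noteq> 0" for j \<mu>
    using that unfolding P_def by (intro UN_I[of j] imageI) (auto simp: in_keys_iff)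
  have "(\<Sum>p\<in>P. vec_part d p v) j = v j" for j
  proof (cases "j < length d")
    case True
    show ?thesis
    proof (rule poly_mapping_eqI)
      fix \<mu>
      have "Poly_Mapping.lookup ((\<Sum>p\<in>P. vec_part d p v) j) \<mu> =
          (\<Sum>p\<in>P. if p = int (monomial_degree \<mu>) + d ! j then Poly_Mapping.lookup (v j) \<mu> else 0)"
        unfolding sum_fun_apply lookup_sum using True
        by (intro sum.cong) (auto simp: vec_part_def when_def)
      also have "\<dots> = Poly_Mapping.lookup (v j) \<mu>"
        using fin P[OF True, of \<mu>] by auto
      finally show "Poly_Mapping.lookup ((\<Sum>p\<in>P. vec_part d p v) j) \<mu> = Poly_Mapping.lookup (v j) \<mu>" .
    qed
  next
    case False
    then show ?thesis
      using assms by (auto simp: sum_fun_apply vec_part_def free_module_def)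
  qed
  moreover have "vec_part d p v = 0" if "p \<notin> P" for p
  proof -
    have "Poly_Mapping.lookup (v j) \<mu> = 0" if "j < length d" "int (monomial_degree \<mu>) = p - d ! j" for j \<mu>
      using P[of j \<mu>] \<open>p \<notin> P\<close> that by auto
    then show ?thesis
      by (auto simp: vec_part_def fun_eq_iff when_def intro!: poly_mapping_eqI)
  qed
  ultimately show ?thesis
    using fin by (intro exI[of _ P]) auto
qed

text \<open>Split \<open>v\<close> into its parts: \<open>f\<close> sends the part of degree
  \<open>p\<close> into degree \<open>p\<close>, so only \<open>p = m\<close> survives.\<close>

lemma vec_part_graded_hom:
  assumes f: "f \<in> module_hom mpoly_ring (free_module d) (free_module d')"
    and gr: "\<And>m. f ` free_module_component d m \<subseteq> free_module_component d' m"
    and v: "v \<in> carrier (free_module d)"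
  shows "vec_part d' m (f v) = f (vec_part d m v)"
proof -
  interpret f: Vector_Spaces.linear vec_scale vec_scale "\<lambda>v. f (truncate_vec d v)"
    by (rule linear_module_hom_truncate[OF f])
  interpret h: Vector_Spaces.linear vec_scale vec_scale "vec_part d' m"
    by (rule linear_vec_part)
  have f_part: "f (truncate_vec d (vec_part d p v)) = f (vec_part d p v)" for p
    by (simp add: truncate_component[OF vec_part_in_component])
  have f0: "f 0 = 0"
    using f.zero by (simp add: truncate_vec_def zero_fun_def)
  obtain P where P: "finite P" "v = (\<Sum>p\<in>P. vec_part d p v)" "\<And>p. p \<notin> P \<Longrightarrow> vec_part d p v = 0"
    using vec_part_sum[OF v] by blast
  have "f v = f (truncate_vec d (\<Sum>p\<in>P. vec_part d p v))"
    using P(2) truncate_id[OF v] by simp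
  also have "\<dots> = (\<Sum>p\<in>P. f (vec_part d p v))"
    by (simp add: f.sum f_part)
  finally have "vec_part d' m (f v) = (\<Sum>p\<in>P. vec_part d' m (f (vec_part d p v)))"
    by (simp add: h.sum)
  also have "\<dots> = (\<Sum>p\<in>P. if m = p then f (vec_part d p v) else 0)"
    using gr vec_part_in_component by (intro sum.cong refl vec_part_component) blast
  \<comment> \<open>If \<open>m\<close> is not in \<open>P\<close>, both sides are zero, by
    \<open>f 0 = 0\<close>.\<close>
  also have "\<dots> = f (vec_part d m v)"
    using P(1,3) f0 by auto
  finally show ?thesis .
qed

section \<open>The dimension count along the resolution\<close>

context
  fixes I :: "('n::finite, 'k::field) mpoly set" and D :: "nat \<Rightarrow> int list"
    and \<phi> :: "nat \<Rightarrow> (nat \<Rightarrow> ('n, 'k) mpoly) \<Rightarrow> (nat \<Rightarrow> ('n, 'k) mpoly)"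
  assumes res: "minimal_graded_free_resolution I D \<phi>"
begin

private abbreviation F where "F i \<equiv> free_module (D i) :: (('n, 'k) mpoly, nat \<Rightarrow> ('n, 'k) mpoly) module"
private abbreviation Fc where "Fc i \<equiv> free_module_component (D i) :: int \<Rightarrow> (nat \<Rightarrow> ('n, 'k) mpoly) set"

lemma resolution_facts:
  shows D0: "D 0 = [0]"
    and hom: "\<phi> (Suc i) \<in> module_hom mpoly_ring (F (Suc i)) (F i)"
    and graded: "\<phi> (Suc i) ` Fc (Suc i) m \<subseteq> Fc i m"
    and image_1: "\<phi> 1 ` carrier (F 1) = {v \<in> carrier (F 0). v 0 \<in> I}"
    and exact: "\<phi> (Suc (Suc i)) ` carrier (F (Suc (Suc i))) = {v \<in> carrier (F (Suc i)). \<phi> (Suc i) v = 0}"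
    and minimal: "v \<in> carrier (F (Suc i)) \<Longrightarrow> \<phi> (Suc i) v j \<in> irrelevant_ideal"
  using res by (auto simp: minimal_graded_free_resolution_def exact_at_def zero_fun_def free_module_def)

text \<open>A preimage of a homogeneous element can be replaced by its part of the same degree, so
  exactness holds degree by degree. The set \<open>U\<close> stands both for the kernel of the next
  map and for the vectors with entry 0 in \<open>I\<close>.\<close>

lemma graded_image_eq:
  assumes im: "\<phi> (Suc i) ` carrier (F (Suc i)) = {v \<in> carrier (F i). v \<in> U}"
  shows "\<phi> (Suc i) ` Fc (Suc i) m = {v \<in> Fc i m. v \<in> U}"
proof (intro equalityI subsetI)
  fix w assume "w \<in> \<phi> (Suc i) ` Fc (Suc i) m"
  then obtain v where v: "v \<in> Fc (Suc i) m" "w = \<phi> (Suc i) v" by blast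
  then have "v \<in> carrier (F (Suc i))"
    using free_module_component_carrier by blast
  then have "w \<in> U" using im v(2) by blast
  then show "w \<in> {v \<in> Fc i m. v \<in> U}"
    using graded v by blast
next
  fix w assume w: "w \<in> {v \<in> Fc i m. v \<in> U}"
  then have "w \<in> \<phi> (Suc i) ` carrier (F (Suc i))"
    unfolding im using free_module_component_carrier by blast
  then obtain v where v: "v \<in> carrier (F (Suc i))" "w = \<phi> (Suc i) v" by blast
  have "w = vec_part (D i) m w"
    using w vec_part_component[of w "D i" m m] by simp
  also have "\<dots> = \<phi> (Suc i) (vec_part (D (Suc i)) m v)"
    unfolding v(2) by (rule vec_part_graded_hom[OF hom graded v(1)])
  finally show "w \<in> \<phi> (Suc i) ` Fc (Suc i) m"
    using vec_part_in_component by blast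
qed

text \<open>The ideal is the image of a graded map, and graded maps commute with taking
  parts.\<close>

lemma homogeneous_part_resolved_ideal:
  assumes "f \<in> I"
  shows "homogeneous_part m f \<in> I"
proof -
  define w where "w = (\<lambda>j :: nat. if j = 0 then f else 0)"
  have "w \<in> \<phi> 1 ` carrier (F 1)"
    unfolding image_1 using assms by (simp add: w_def free_module_def D0)
  then obtain v where v: "v \<in> carrier (F 1)" "w = \<phi> 1 v" by blast
  have "vec_part (D 0) m w = \<phi> 1 (vec_part (D 1) m v)"
    using vec_part_graded_hom[OF hom[of 0] graded[of 0], of v m] v by simp
  then have "vec_part (D 0) m w \<in> \<phi> 1 ` carrier (F 1)"
    using vec_part_in_component free_module_component_carrier by blast
  then show ?thesis
    unfolding image_1 by (simp add: w_def vec_part_def D0)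
qed

text \<open>Minimality: a basis vector \<open>e\<close> in the kernel would lie in the next image,
  and its entry 1 in the irrelevant ideal. So its image has a nonzero entry \<open>q\<close>, whose
  degree \<open>D (Suc i) ! j - D i ! q\<close> cannot be negative. This makes the numerator a
  polynomial.\<close>

lemma shifts_nonneg: "j < length (D i) \<Longrightarrow> 0 \<le> D i ! j"
proof (induction i arbitrary: j)
  case 0
  then show ?case by (simp add: D0)
next
  case (Suc i)
  define e where "e = (\<lambda>q. if q = j then 1 else 0 :: ('n, 'k) mpoly)"
  have e: "e \<in> Fc (Suc i) (D (Suc i) ! j)"
    using Suc.prems by (auto simp: e_def free_module_component_def free_module_def
        homogeneous_component_def monomial_degree_def)
  then have ec: "e \<in> carrier (F (Suc i))"
    using free_module_component_carrier by blast
  have "\<phi> (Suc i) e \<noteq> 0"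
  proof
    assume "\<phi> (Suc i) e = 0"
    then have "e \<in> \<phi> (Suc (Suc i)) ` carrier (F (Suc (Suc i)))"
      unfolding exact using ec by simp
    then obtain v where "v \<in> carrier (F (Suc (Suc i)))" "e = \<phi> (Suc (Suc i)) v" by blast
    then have "e j \<in> irrelevant_ideal"
      using minimal by blast
    then show False
      using one_notin_irrelevant_ideal[where 'n = 'n and 'k = 'k] by (simp add: e_def)
  qed
  then obtain q where q: "\<phi> (Suc i) e q \<noteq> 0" by (auto simp: fun_eq_iff)
  have "\<phi> (Suc i) e \<in> Fc i (D (Suc i) ! j)"
    using graded e by blast
  then have "q < length (D i)" "\<phi> (Suc i) e q \<in> homogeneous_component (D (Suc i) ! j - D i ! q)"
    using q by (auto simp: free_module_component_def free_module_def not_less[symmetric])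
  moreover obtain \<mu> where "\<mu> \<in> Poly_Mapping.keys (\<phi> (Suc i) e q)"
    using q by fastforce
  ultimately show ?case
    using Suc.IH[of q] by (fastforce simp: homogeneous_component_def)
qed

text \<open>Rank-nullity in degree \<open>m\<close>, where exactness turns each rank into the
  nullity of the following map.\<close>

lemma dim_kernel_recursion:
  "vecs.dim (Fc (Suc (Suc i)) m) =
    vecs.dim {v \<in> Fc (Suc (Suc i)) m. \<phi> (Suc (Suc i)) v = 0} + vecs.dim {v \<in> Fc (Suc i) m. \<phi> (Suc i) v = 0}"
  and dim_kernel_recursion_1:
  "vecs.dim (Fc 1 m) = vecs.dim {v \<in> Fc 1 m. \<phi> 1 v = 0} + polys.dim (I \<inter> homogeneous_component m)"
  and dim_component_0: "vecs.dim (Fc 0 m) = polys.dim (homogeneous_component m :: ('n, 'k) mpoly set)"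
proof -
  have rn: "vecs.dim (Fc (Suc i) m) =
    vecs.dim {v \<in> Fc (Suc i) m. \<phi> (Suc i) v = 0} + vecs.dim (\<phi> (Suc i) ` Fc (Suc i) m)" for i
  proof -
    obtain T :: "(nat \<Rightarrow> ('n, 'k) mpoly) set" where T: "finite T" "Fc (Suc i) m \<subseteq> vecs.span T"
      using free_module_component_finite_span by blast
    have tr: "\<phi> (Suc i) (truncate_vec (D (Suc i)) v) = \<phi> (Suc i) v" if "v \<in> Fc (Suc i) m" for v
      by (simp add: truncate_component[OF that])
    then have "(\<lambda>v. \<phi> (Suc i) (truncate_vec (D (Suc i)) v)) ` Fc (Suc i) m = \<phi> (Suc i) ` Fc (Suc i) m"
      by (intro image_cong) auto
    moreover have "{v \<in> Fc (Suc i) m. \<phi> (Suc i) (truncate_vec (D (Suc i)) v) = 0} =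
        {v \<in> Fc (Suc i) m. \<phi> (Suc i) v = 0}"
      using tr by auto
    ultimately show ?thesis
      using vecs_vecs.dim_eq_dim_kernel_plus_dim_image[OF linear_module_hom_truncate[OF hom[of i]]
          subspace_free_module_component T(2,1)] by simp
  qed
  show "vecs.dim (Fc (Suc (Suc i)) m) =
    vecs.dim {v \<in> Fc (Suc (Suc i)) m. \<phi> (Suc (Suc i)) v = 0} + vecs.dim {v \<in> Fc (Suc i) m. \<phi> (Suc i) v = 0}"
    using rn[of "Suc i"] graded_image_eq[of "Suc i" "{v. \<phi> (Suc i) v = 0}" m] exact by simp
  have lin0: "Vector_Spaces.linear vec_scale poly_scale (\<lambda>v. v 0)"
    by (simp add: Vector_Spaces.linear_iff vecs.vector_space_axioms polys.vector_space_axioms)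
  \<comment> \<open>\<open>D 0 = [0]\<close> leaves a single entry, so projecting to it is injective
    and moves dimensions from vectors to polynomials.\<close>
  have proj: "vecs.dim V = polys.dim ((\<lambda>v. v 0) ` V)" if V: "vecs.subspace V" "V \<subseteq> Fc 0 m" for V
  proof -
    obtain T :: "(nat \<Rightarrow> ('n, 'k) mpoly) set" where T: "finite T" "Fc 0 m \<subseteq> vecs.span T"
      using free_module_component_finite_span by blast
    have "v = 0" if "v \<in> V" "v 0 = 0" for v
    proof
      show "v j = 0 j" for j
        using that V(2) by (cases j) (auto simp: free_module_component_def free_module_def D0)
    qed
    then have "{v \<in> V. v 0 = 0} = {0}"
      using vecs.subspace_0[OF V(1)] by auto
    moreover have "vecs.dim {0 :: nat \<Rightarrow> ('n, 'k) mpoly} = 0"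
      by (rule vecs.dim_unique[of "{}"]) (simp_all add: vecs.independent_empty)
    moreover have "V \<subseteq> vecs.span T" using V(2) T(2) by blast
    ultimately show ?thesis
      using vecs_polys.dim_eq_dim_kernel_plus_dim_image[OF lin0 V(1) _ T(1)] by simp
  qed
  have image0: "(\<lambda>v. v 0) ` {v \<in> Fc 0 m. v 0 \<in> J} = J \<inter> homogeneous_component m" for J :: "('n, 'k) mpoly set"
  proof (intro equalityI subsetI)
    fix f assume f: "f \<in> J \<inter> homogeneous_component m"
    then show "f \<in> (\<lambda>v. v 0) ` {v \<in> Fc 0 m. v 0 \<in> J}"
      by (intro image_eqI[of _ _ "\<lambda>j. if j = 0 then f else 0"])
        (auto simp: free_module_component_def free_module_def D0)
  qed (auto simp: free_module_component_def free_module_def D0)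
  show "vecs.dim (Fc 0 m) = polys.dim (homogeneous_component m :: ('n, 'k) mpoly set)"
    using proj[OF subspace_free_module_component subset_refl] image0[of UNIV] by simp
  have im1: "\<phi> 1 ` Fc 1 m = {v \<in> Fc 0 m. v 0 \<in> I}"
    using graded_image_eq[of 0 "{v. v 0 \<in> I}" m] image_1 by simp
  interpret f: Vector_Spaces.linear vec_scale vec_scale "\<lambda>v. \<phi> (Suc 0) (truncate_vec (D (Suc 0)) v)"
    by (rule linear_module_hom_truncate[OF hom])
  have "\<phi> 1 ` Fc 1 m = (\<lambda>v. \<phi> (Suc 0) (truncate_vec (D (Suc 0)) v)) ` Fc 1 m"
    by (intro image_cong refl) (simp add: truncate_component)
  then have "vecs.subspace (\<phi> 1 ` Fc 1 m)"
    using f.subspace_image[OF subspace_free_module_component] by simp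
  then have "vecs.dim (\<phi> 1 ` Fc 1 m) = polys.dim (I \<inter> homogeneous_component m)"
    using proj[of "\<phi> 1 ` Fc 1 m"] image0[of I] im1 by auto
  then show "vecs.dim (Fc 1 m) = vecs.dim {v \<in> Fc 1 m. \<phi> 1 v = 0} + polys.dim (I \<inter> homogeneous_component m)"
    using rn[of 0] by simp
qed

lemma hilbert_function_eq_alternating_sum:
  assumes I: "ideal I mpoly_ring" "1 \<notin> I" and fin: "\<And>i. i > L \<Longrightarrow> D i = []"
  shows "int (hilbert_function I m) = (\<Sum>i\<le>L. (- 1) ^ i *
    (\<Sum>j<length (D i). int (card {\<mu> :: 'n \<Rightarrow>\<^sub>0 nat. int (monomial_degree \<mu>) = int m - D i ! j})))"
proof -
  define N where "N = (\<lambda>i. int (vecs.dim (Fc i (int m))))"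
  define Z where "Z = (\<lambda>i. int (vecs.dim {v \<in> Fc i (int m). \<phi> i v = 0}))"
  have N: "N i = (\<Sum>j<length (D i). int (card {\<mu> :: 'n \<Rightarrow>\<^sub>0 nat. int (monomial_degree \<mu>) = int m - D i ! j}))" for i
    unfolding N_def dim_free_module_component by simp
  \<comment> \<open>The error term is, up to sign, the rank of \<open>\<phi> (Suc L)\<close> in
    degree \<open>m\<close>; it vanishes once the modules are zero.\<close>
  have *: "int (hilbert_function I m) = (\<Sum>i\<le>L. (- 1) ^ i * N i) + (- 1) ^ Suc L * (N (Suc L) - Z (Suc L))" for L
  proof (induction L)
    case 0
    show ?case
      using hilbert_function_plus_dim[OF I, of m] dim_kernel_recursion_1[of "int m"] dim_component_0[of "int m"]
      by (simp add: N_def Z_def)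
  next
    case (Suc L)
    have "N (Suc (Suc L)) = Z (Suc (Suc L)) + Z (Suc L)"
      unfolding N_def Z_def using dim_kernel_recursion[of L "int m"] by simp
    then show ?case using Suc.IH by (simp add: algebra_simps)
  qed
  obtain T :: "(nat \<Rightarrow> ('n, 'k) mpoly) set" where T: "finite T" "Fc (Suc L) (int m) \<subseteq> vecs.span T"
    using free_module_component_finite_span by blast
  have "N (Suc L) = 0" unfolding N using fin[of "Suc L"] by simp
  moreover have "Z (Suc L) \<le> N (Suc L)"
    unfolding N_def Z_def using vecs.dim_mono_finite[OF _ T(2,1)] by auto
  ultimately have "N (Suc L) - Z (Suc L) = 0" by (simp add: Z_def)
  with *[of L] show ?thesis by (simp add: N)
qed

lemma hilbert_series_times:
  assumes I: "ideal I mpoly_ring" "1 \<notin> I" and fin: "\<And>i. i > L \<Longrightarrow> D i = []"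
  shows "hilbert_series I * (1 - fps_X) ^ CARD('n) =
    fps_of_poly (\<Sum>i\<le>L. (- 1) ^ i * (\<Sum>j<length (D i). monom 1 (nat (D i ! j))))"
proof -
  define A :: "rat fps" where "A = Abs_fps (\<lambda>m. of_nat (card {\<mu> :: 'n \<Rightarrow>\<^sub>0 nat. monomial_degree \<mu> = m}))"
  have A: "A * (1 - fps_X) ^ CARD('n) = 1"
    unfolding A_def card_monomials_degree_eq by (rule fps_binomial_mult_one_minus_power)
  \<comment> \<open>A twist by \<open>d\<close> multiplies the series of the ring by
    \<open>fps_X ^ d\<close>; for negative \<open>d\<close>, \<open>nat d\<close> would be
    wrong.\<close>
  have shift: "fps_nth (fps_X ^ nat d * A) m =
      of_nat (card {\<mu> :: 'n \<Rightarrow>\<^sub>0 nat. int (monomial_degree \<mu>) = int m - d})" if "d \<ge> 0" for d m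
  proof (cases "nat d \<le> m")
    case True
    then have "{\<mu> :: 'n \<Rightarrow>\<^sub>0 nat. int (monomial_degree \<mu>) = int m - d} = {\<mu>. monomial_degree \<mu> = m - nat d}"
      using that by auto
    with True show ?thesis by (simp add: fps_X_power_mult_nth A_def)
  next
    case False
    then have "{\<mu> :: 'n \<Rightarrow>\<^sub>0 nat. int (monomial_degree \<mu>) = int m - d} = {}"
      using that by auto
    with False show ?thesis by (simp only: fps_X_power_mult_nth card.empty of_nat_0) simp
  qed
  have "hilbert_series I = (\<Sum>i\<le>L. (- 1) ^ i * (\<Sum>j<length (D i). fps_X ^ nat (D i ! j) * A))"
  proof (rule fps_ext)
    fix m
    have "fps_nth (hilbert_series I) m = of_int (int (hilbert_function I m))"
      by (simp add: hilbert_series_def)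
    also have "\<dots> = (\<Sum>i\<le>L. (- 1) ^ i * (\<Sum>j<length (D i). fps_nth (fps_X ^ nat (D i ! j) * A) m))"
      by (subst hilbert_function_eq_alternating_sum[OF I, of L])
        (use fin in simp, simp add: shift shifts_nonneg)
    also have "\<dots> = fps_nth (\<Sum>i\<le>L. (- 1) ^ i * (\<Sum>j<length (D i). fps_X ^ nat (D i ! j) * A)) m"
    proof -
      have "fps_nth ((- 1) ^ i * f) m = (- 1) ^ i * fps_nth f m" for i and f :: "rat fps"
        by (cases "even i") auto
      then show ?thesis by (simp add: fps_sum_nth)
    qed
    finally show "fps_nth (hilbert_series I) m = \<dots>" .
  qed
  also have "\<dots> = (\<Sum>i\<le>L. (- 1) ^ i * (\<Sum>j<length (D i). fps_X ^ nat (D i ! j))) * A"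
    by (simp add: sum_distrib_left sum_distrib_right mult.assoc)
  finally show ?thesis
    using A by (simp add: mult.assoc fps_of_poly_sum fps_of_poly_mult fps_of_poly_power fps_of_poly_monom fps_of_poly_uminus)
qed

end

section \<open>Growth of coefficients and the order of the pole at 1\<close>

lemma fps_nth_sum_of_difference:
  "fps_nth f m = (\<Sum>i\<le>m. fps_nth (f * (1 - fps_X)) i)" for f :: "'a::comm_ring_1 fps"
proof (induction m)
  case (Suc m)
  then show ?case by (simp add: right_diff_distrib)
qed (simp add: right_diff_distrib)

text \<open>A discrete mean value estimate, written additively to stay in
  \<open>nat\<close>.\<close>

lemma power_Suc_diff_le: "Suc m ^ Suc N \<le> m ^ Suc N + Suc N * Suc m ^ N"
proof (induction N)
  case (Suc N)
  have "Suc m ^ Suc (Suc N) \<le> Suc m * (m ^ Suc N + Suc N * Suc m ^ N)"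
    using Suc.IH by (subst power_Suc) (rule mult_le_mono2)
  also have "\<dots> = m ^ Suc (Suc N) + m ^ Suc N + Suc N * Suc m ^ Suc N"
    by (simp add: algebra_simps)
  also have "m ^ Suc N \<le> Suc m ^ Suc N" by (rule power_mono) simp_all
  finally show ?case by (simp add: algebra_simps)
qed simp

text \<open>Multiplying by \<open>1 - fps_X\<close> takes differences. The induction hypothesis
  bounds these below by a multiple of \<open>m ^ N\<close>, and summation raises the exponent by
  one. For \<open>N = 0\<close> the coefficients are eventually \<open>poly u 1\<close>.\<close>

lemma fps_nth_lower_bound:
  fixes f :: "'a::archimedean_field fps"
  assumes "f * (1 - fps_X) ^ Suc N = fps_of_poly u" "poly u 1 > 0"
  shows "\<exists>\<epsilon>>0. \<exists>M. \<forall>m\<ge>M. \<epsilon> * of_nat m ^ N \<le> fps_nth f m"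
  using assms(1)
proof (induction N arbitrary: f)
  case 0
  have "fps_nth f m = poly u 1" if "degree u \<le> m" for m
  proof -
    have "fps_nth f m = (\<Sum>i\<le>m. coeff u i)"
      unfolding fps_nth_sum_of_difference[of f m] using 0 by simp
    also have "\<dots> = (\<Sum>i\<le>degree u. coeff u i)"
      using that by (intro sum.mono_neutral_right) (auto simp: coeff_eq_0)
    finally show ?thesis by (simp add: poly_altdef)
  qed
  then show ?case
    using assms(2) by (intro exI[of _ "poly u 1"] conjI exI[of _ "degree u"]) auto
next
  case (Suc N)
  have "(f * (1 - fps_X)) * (1 - fps_X) ^ Suc N = fps_of_poly u"
    using Suc.prems by (simp add: mult.assoc)
  then obtain \<epsilon> M where e: "\<epsilon> > 0" "\<And>m. m \<ge> M \<Longrightarrow> \<epsilon> * of_nat m ^ N \<le> fps_nth (f * (1 - fps_X)) m"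
    using Suc.IH by blast
  \<comment> \<open>Chosen so that \<open>\<delta> * (Suc m ^ Suc N - m ^ Suc N)\<close> is at most
    \<open>\<epsilon> * Suc m ^ N\<close>; the constant \<open>K\<close> absorbs the start at
    \<open>M\<close>.\<close>
  define \<delta> where "\<delta> = \<epsilon> / of_nat (Suc N)"
  define K where "K = \<delta> * of_nat M ^ Suc N + \<bar>fps_nth f M\<bar>"
  have \<delta>: "\<delta> > 0" "\<epsilon> = \<delta> * of_nat (Suc N)"
    using e(1) by (simp_all add: \<delta>_def del: of_nat_Suc)
  have K: "\<delta> * of_nat m ^ Suc N - K \<le> fps_nth f m" if "M \<le> m" for m
    using that
  proof (induction m rule: dec_induct)
    case base
    show ?case by (simp add: K_def)
  next
    case (step m)
    have "of_nat (Suc m ^ Suc N) \<le> (of_nat (m ^ Suc N + Suc N * Suc m ^ N) :: 'a)"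
      by (simp only: of_nat_le_iff power_Suc_diff_le)
    then have "\<delta> * of_nat (Suc m) ^ Suc N \<le> \<delta> * (of_nat m ^ Suc N + of_nat (Suc N) * of_nat (Suc m) ^ N)"
      using \<delta>(1) by (simp only: of_nat_add of_nat_mult of_nat_power mult_le_cancel_left_pos)
    also have "\<dots> = \<delta> * of_nat m ^ Suc N + \<epsilon> * of_nat (Suc m) ^ N"
      by (simp only: \<delta>(2) distrib_left mult.assoc)
    also have "\<dots> \<le> \<delta> * of_nat m ^ Suc N + fps_nth (f * (1 - fps_X)) (Suc m)"
      using e(2)[of "Suc m"] step by simp
    also have "\<dots> = \<delta> * of_nat m ^ Suc N + (fps_nth f (Suc m) - fps_nth f m)"
      by (simp add: right_diff_distrib)
    finally show ?case using step.IH by simp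
  qed
  \<comment> \<open>From \<open>k\<close> on, half of the main term outweighs
    \<open>K\<close>.\<close>
  obtain k :: nat where k: "K \<le> of_nat k * (\<delta> / 2)"
    using ex_less_of_nat_mult[of "\<delta> / 2" K] \<delta>(1) by (auto intro: less_imp_le)
  have "\<delta> / 2 * of_nat m ^ Suc N \<le> fps_nth f m" if "max M (max k 1) \<le> m" for m
  proof -
    have "K \<le> of_nat m * (\<delta> / 2)"
      using k that \<delta>(1) by (elim order_trans) (intro mult_right_mono, auto)
    also have "\<dots> \<le> of_nat m ^ Suc N * (\<delta> / 2)"
    proof -
      have "m ^ 1 \<le> m ^ Suc N" using that by (intro power_increasing) auto
      then have "(of_nat m :: 'a) \<le> of_nat (m ^ Suc N)"
        by (simp only: of_nat_le_iff power_one_right)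
      then have "(of_nat m :: 'a) \<le> of_nat m ^ Suc N"
        by (simp only: of_nat_power)
      then show ?thesis
        using \<delta>(1) by (intro mult_right_mono) simp_all
    qed
    finally show ?thesis
      using K[of m] that by (simp add: algebra_simps)
  qed
  then show ?case
    using \<delta>(1) by (intro exI[of _ "\<delta> / 2"] conjI exI[of _ "max M (max k 1)"]) auto
qed

text \<open>Write \<open>p = q ^ j * u\<close> with \<open>q = [:1, - 1:]\<close> and
  \<open>poly u 1 \<noteq> 0\<close>. If \<open>j < s\<close>, the pole of order
  \<open>Suc (n - j)\<close> makes the coefficients at least a multiple of
  \<open>m ^ (n - j)\<close>, too large for the bound. In the application \<open>f\<close> collects
  partial sums, which explains the exponent \<open>Suc n\<close>.\<close>

lemma one_minus_power_dvd_if_growth: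
  fixes f :: "'a::archimedean_field fps"
  assumes f: "f * (1 - fps_X) ^ Suc n = fps_of_poly p" and s: "s \<le> n"
    and growth: "\<And>m. of_nat (m + 1) ^ s * \<bar>fps_nth f m\<bar> \<le> C * of_nat (m + 1) ^ n"
  shows "[:1, - 1:] ^ s dvd p"
proof (cases "p = 0")
  case False
  define q where "q = [:1, - 1 :: 'a:]"
  have q: "fps_of_poly q = 1 - fps_X"
    by (simp add: q_def fps_of_poly_pCons)
  obtain u0 where u0: "p = [:- 1, 1:] ^ order 1 p * u0" "\<not> [:- 1, 1:] dvd u0"
    using order_decomp[OF False, of 1] by blast
  define j where "j = order 1 p"
  \<comment> \<open>The order of a root counts factors \<open>[:- 1, 1:]\<close>; the sign goes into
    \<open>u\<close>.\<close>
  define u where "u = (- 1) ^ j * u0"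
  have "[:- 1, 1 :: 'a:] = - q" by (simp add: q_def)
  then have pu: "p = q ^ j * u"
    using u0(1) unfolding j_def[symmetric] u_def by (simp add: power_minus[of q] ac_simps)
  have "poly u 1 \<noteq> 0"
    using u0(2) by (simp add: u_def poly_eq_0_iff_dvd)
  have "s \<le> j"
  proof (rule ccontr)
    assume "\<not> s \<le> j"
    then have j: "j < s" "j \<le> n" using s by simp_all
    have eq: "(1 - fps_X) ^ j * (f * (1 - fps_X) ^ Suc (n - j)) = (1 - fps_X) ^ j * fps_of_poly u"
    proof -
      have "Suc n = j + Suc (n - j)" using j by simp
      then have "f * (1 - fps_X) ^ Suc n = (1 - fps_X) ^ j * (f * (1 - fps_X) ^ Suc (n - j))"
        by (simp only: power_add ac_simps)
      then show ?thesis
        using f by (simp only: pu fps_of_poly_mult fps_of_poly_power q)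
    qed
    have "(1 - fps_X :: 'a fps) ^ j \<noteq> 0"
    proof -
      have "fps_nth (1 - fps_X :: 'a fps) 0 \<noteq> 0" by simp
      then show ?thesis by (metis fps_zero_nth power_eq_0_iff)
    qed
    from mult_left_cancel[OF this] eq have fu: "f * (1 - fps_X) ^ Suc (n - j) = fps_of_poly u"
      by blast
    have "\<exists>\<epsilon>>0. \<exists>M. \<forall>m\<ge>M. \<epsilon> * of_nat m ^ (n - j) \<le> \<bar>fps_nth f m\<bar>"
    proof (cases "poly u 1 > 0")
      case True
      show ?thesis
        using fps_nth_lower_bound[OF fu True] by (meson abs_ge_self order_trans)
    next
      case False
      then have pos: "poly (- u) 1 > 0" using \<open>poly u 1 \<noteq> 0\<close> by simp
      have "(- f) * (1 - fps_X) ^ Suc (n - j) = fps_of_poly (- u)"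
        using fu by (simp add: fps_of_poly_uminus)
      from fps_nth_lower_bound[OF this pos] show ?thesis
        by (metis abs_ge_minus_self fps_neg_nth order_trans)
    qed
    then obtain \<epsilon> M where e: "\<epsilon> > 0" "\<And>m. m \<ge> M \<Longrightarrow> \<epsilon> * of_nat m ^ (n - j) \<le> \<bar>fps_nth f m\<bar>"
      by blast
    \<comment> \<open>Replacing \<open>m\<close> by \<open>m + 1 \<le> 2 * m\<close> in the lower
      bound costs \<open>2 ^ (n - j)\<close>.\<close>
    define E where "E = \<epsilon> / 2 ^ (n - j)"
    have E: "E > 0" using e(1) by (simp add: E_def)
    \<comment> \<open>Cancelling powers will leave \<open>(m + 1) * E \<le> C\<close>, impossible
      for \<open>m \<ge> k\<close>.\<close>
    obtain k :: nat where k: "C < of_nat k * E"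
      using ex_less_of_nat_mult[of E C] E by auto
    define m where "m = max (max M k) 1"
    have m: "M \<le> m" "k \<le> m" "1 \<le> m" by (simp_all add: m_def)
    let ?t = "of_nat (m + 1) :: 'a"
    have t: "?t > 0" by (simp del: of_nat_Suc)
    have "?t ^ s * (E * ?t ^ (n - j)) \<le> ?t ^ s * \<bar>fps_nth f m\<bar>"
    proof -
      have "?t \<le> 2 * of_nat m"
        using m(3) by simp
      then have "?t ^ (n - j) \<le> (2 * of_nat m) ^ (n - j)"
        by (rule power_mono) simp
      then have "E * ?t ^ (n - j) \<le> E * (2 * of_nat m) ^ (n - j)"
        using E by (intro mult_left_mono) auto
      also have "\<dots> = \<epsilon> * of_nat m ^ (n - j)"
        by (simp add: E_def power_mult_distrib)
      finally have "E * ?t ^ (n - j) \<le> \<bar>fps_nth f m\<bar>"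
        using e(2)[OF m(1)] by simp
      then show ?thesis by (intro mult_left_mono) auto
    qed
    also have "\<dots> \<le> C * ?t ^ n" by (rule growth)
    also have "\<dots> = C * (?t ^ (n - j) * ?t ^ j)"
      using j by (simp flip: power_add)
    finally have "?t ^ s * E \<le> C * ?t ^ j"
      using t by (simp add: mult.assoc[symmetric] mult.commute[of _ "?t ^ (n - j)"] del: of_nat_Suc of_nat_add)
    moreover have "?t ^ Suc j * E \<le> ?t ^ s * E"
      using E j by (intro mult_right_mono power_increasing) auto
    ultimately have "(?t * E) * ?t ^ j \<le> C * ?t ^ j"
      by (simp add: ac_simps)
    then have "?t * E \<le> C"
      using t by (simp del: of_nat_Suc of_nat_add)
    moreover have "of_nat k * E \<le> ?t * E"
    proof (rule mult_right_mono)
      show "of_nat k \<le> ?t" using m(2) by (subst of_nat_le_iff) simp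
    qed (use E in simp)
    ultimately show False using k by simp
  qed
  then have "q ^ s dvd q ^ j" by (rule le_imp_power_dvd)
  then show ?thesis unfolding q_def[symmetric] pu by (rule dvd_mult2)
qed simp

section \<open>Taylor coefficients at 1\<close>

lemma higher_pderiv_pcompose_shift:
  "pcompose ((pderiv ^^ l) p) [:1, 1 :: 'a::field_char_0:] = (pderiv ^^ l) (pcompose p [:1, 1:])"
proof (induction l arbitrary: p)
  case (Suc l)
  have "pderiv (pcompose p [:1, 1 :: 'a:]) = pcompose (pderiv p) [:1, 1:]"
    by (simp add: pderiv_pcompose pderiv_pCons)
  then show ?case
    using Suc[of "pderiv p"] by (simp add: funpow_Suc_right del: funpow.simps)
qed simp

text \<open>Composition with \<open>[:1, 1:]\<close> moves the expansion point from 1 to 0, where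
  derivatives are coefficients up to a factorial.\<close>

lemma poly_higher_pderiv_one:
  "poly ((pderiv ^^ l) p) (1 :: 'a::field_char_0) = fact l * coeff (pcompose p [:1, 1:]) l"
proof -
  have "poly ((pderiv ^^ l) p) 1 = poly (pcompose ((pderiv ^^ l) p) [:1, 1:]) 0"
    by (simp add: poly_pcompose)
  also have "\<dots> = coeff ((pderiv ^^ l) (pcompose p [:1, 1:])) 0"
    by (simp add: higher_pderiv_pcompose_shift poly_0_coeff_0)
  also have "\<dots> = fact l * coeff (pcompose p [:1, 1:]) l"
    by (simp add: coeff_higher_pderiv pochhammer_fact)
  finally show ?thesis .
qed

lemma coeff_pcompose_monom_shift:
  "coeff (pcompose (monom 1 d) [:1, 1 :: 'a::comm_ring_1:]) m = of_nat (d choose m)"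
proof -
  have "pcompose (monom 1 d) [:1, 1 :: 'a:] = [:1, 1:] ^ d"
    by (induction d) (simp_all add: monom_Suc pcompose_pCons monom_0 pcompose_1 flip: one_pCons)
  then show ?thesis
    by (cases "m \<le> d") (simp_all add: coeff_linear_poly_power coeff_eq_0 degree_linear_power binomial_eq_0)
qed

section \<open>Power sums of the shifts\<close>

text \<open>Vieta: the product expands over the subsets that supply the constants, and these are
  grouped by cardinality.\<close>

lemma prod_diff_elementary_symmetric:
  "(\<Prod>i=1..N. x - of_nat i) =
    (\<Sum>q\<le>N. (- 1) ^ q * of_nat (elementary_symmetric N q) * x ^ (N - q))" for x :: "'a::comm_ring_1"
proof -
  have "(\<Prod>i=1..N. x - of_nat i) = (\<Prod>i\<in>{1..N}. - of_nat i + x)"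
    by (simp add: algebra_simps)
  also have "\<dots> = (\<Sum>\<xi>\<in>Pow {1..N}. (\<Prod>i\<in>\<xi>. - of_nat i) * (\<Prod>i\<in>{1..N} - \<xi>. x))"
    by (rule prod_add) simp
  also have "\<dots> = (\<Sum>\<xi>\<in>Pow {1..N}. (- 1) ^ card \<xi> * of_nat (\<Prod>\<xi>) * x ^ (N - card \<xi>))"
  proof (rule sum.cong[OF refl])
    fix \<xi> assume \<xi>: "\<xi> \<in> Pow {1..N}"
    then have "card ({1..N} - \<xi>) = N - card \<xi>"
      by (simp add: card_Diff_subset finite_subset)
    moreover have "(\<Prod>i\<in>\<xi>. - of_nat i) = ((- 1) ^ card \<xi> * of_nat (\<Prod>\<xi>) :: 'a)"
      using prod.distrib[of "\<lambda>_. - 1" "\<lambda>i. of_nat i :: 'a" \<xi>] by simp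
    ultimately show "(\<Prod>i\<in>\<xi>. - of_nat i) * (\<Prod>i\<in>{1..N} - \<xi>. x) =
        (- 1) ^ card \<xi> * of_nat (\<Prod>\<xi>) * x ^ (N - card \<xi>)"
      by simp
  qed
  also have "\<dots> = (\<Sum>q\<le>N. \<Sum>\<xi> | \<xi> \<in> Pow {1..N} \<and> card \<xi> = q. (- 1) ^ card \<xi> * of_nat (\<Prod>\<xi>) * x ^ (N - card \<xi>))"
  proof (rule sum.group[symmetric])
    show "card ` Pow {1..N} \<subseteq> {..N}"
      using card_mono[of "{1..N}"] by fastforce
  qed simp_all
  also have "\<dots> = (\<Sum>q\<le>N. (- 1) ^ q * of_nat (elementary_symmetric N q) * x ^ (N - q))"
    by (intro sum.cong refl) (simp add: elementary_symmetric_def sum_distrib_left sum_distrib_right)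
  finally show ?thesis .
qed

text \<open>Splitting off the factor \<open>x\<close> of the falling factorial leaves the roots
  \<open>1..N\<close>; this is the origin of the bound \<open>s + l - 1\<close> in the result. The
  coefficients are signed Stirling numbers of the first kind.\<close>

lemma fact_mult_gchoose_Suc:
  "fact (Suc N) * (x gchoose Suc N) =
    (\<Sum>q\<le>N. (- 1) ^ q * of_nat (elementary_symmetric N q) * x ^ (Suc N - q))" for x :: "'a::field_char_0"
proof -
  have "fact (Suc N) * (x gchoose Suc N) = x * (\<Prod>i=1..N. x - of_nat i)"
    unfolding gbinomial_mult_fact
    by (subst prod.atLeast_Suc_lessThan) (simp_all add: atLeastLessThanSuc_atLeastAtMost del: prod.op_ivl_Suc)
  also have "\<dots> = (\<Sum>q\<le>N. (- 1) ^ q * of_nat (elementary_symmetric N q) * x ^ (Suc N - q))"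
    unfolding prod_diff_elementary_symmetric sum_distrib_left
    by (intro sum.cong refl) (simp add: Suc_diff_le)
  finally show ?thesis .
qed

text \<open>A linear functional of \<open>g\<close>: binomials give the Taylor coefficients of the
  numerator at 1, powers give the power sums of the shifts.\<close>

definition alternating_sum :: "(nat \<Rightarrow> int list) \<Rightarrow> nat \<Rightarrow> (int \<Rightarrow> rat) \<Rightarrow> rat"
  where "alternating_sum D L g = (\<Sum>i\<le>L. (- 1) ^ i * (\<Sum>j<length (D i). g (D i ! j)))"

lemma alternating_sum_scale: "alternating_sum D L (\<lambda>x. a * g x) = a * alternating_sum D L g"
  by (simp add: alternating_sum_def sum_distrib_left ac_simps)

lemma alternating_sum_sum: "alternating_sum D L (\<lambda>x. \<Sum>q\<in>Q. g q x) = (\<Sum>q\<in>Q. alternating_sum D L (g q))"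
  by (induction Q rule: infinite_finite_induct) (simp_all add: alternating_sum_def sum.distrib distrib_left)

text \<open>The vanishing of the first \<open>s\<close> factorial moments is that of the first \<open>s\<close> power sums, so that
  only the top terms of the falling factorial survive.\<close>

lemma factorial_moments_imp_power_sums:
  assumes vanish: "\<And>m. m < s \<Longrightarrow> alternating_sum D L (\<lambda>x. of_int x gchoose m) = 0"
  shows "m < s \<Longrightarrow> alternating_sum D L (\<lambda>x. of_int x ^ m) = 0"
    and "s \<ge> 1 \<Longrightarrow> fact (s + l) * alternating_sum D L (\<lambda>x. of_int x gchoose (s + l)) =
      (\<Sum>\<rho>\<le>l. (- 1) ^ (l - \<rho>) * of_nat (elementary_symmetric (s + l - 1) (l - \<rho>)) *
        alternating_sum D L (\<lambda>x. of_int x ^ (s + \<rho>)))"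
proof -
  let ?p = "\<lambda>m. alternating_sum D L (\<lambda>x. of_int x ^ m)"
  have exp: "fact (Suc N) * alternating_sum D L (\<lambda>x. of_int x gchoose Suc N) =
      (\<Sum>q\<le>N. (- 1) ^ q * of_nat (elementary_symmetric N q) * ?p (Suc N - q))" for N
    by (simp only: alternating_sum_scale[symmetric] fact_mult_gchoose_Suc alternating_sum_sum)
  have zero: "?p m = 0" if "m < s" for m
    using that
  proof (induction m rule: less_induct)
    case (less m)
    show ?case
    proof (cases m)
      case 0
      then show ?thesis using vanish[of 0] less.prems by simp
    next
      case (Suc N)
      have "0 = (\<Sum>q\<le>N. (- 1) ^ q * of_nat (elementary_symmetric N q) * ?p (Suc N - q))"
        using exp[of N] vanish[of "Suc N"] less.prems Suc by simp
      \<comment> \<open>For \<open>0 < q \<le> N\<close> the exponent \<open>Suc N - q\<close> is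
        below \<open>m\<close>, where the induction hypothesis applies.\<close>
      also have "\<dots> = (\<Sum>q\<in>{0}. (- 1) ^ q * of_nat (elementary_symmetric N q) * ?p (Suc N - q))"
        using less Suc by (intro sum.mono_neutral_right) auto
      also have "\<dots> = of_nat (elementary_symmetric N 0) * ?p m"
        by (simp add: Suc)
      also have "elementary_symmetric N 0 = 1"
      proof -
        have "{\<xi>. \<xi> \<subseteq> {1..N} \<and> card \<xi> = 0} = {{}}"
          by (auto dest: finite_subset)
        then show ?thesis by (simp add: elementary_symmetric_def)
      qed
      finally show ?thesis by simp
    qed
  qed
  then show "m < s \<Longrightarrow> ?p m = 0" .
  assume s: "s \<ge> 1"
  define N where "N = s + l - 1"
  have N: "s + l = Suc N" "l \<le> N" using s by (auto simp: N_def)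
  have "fact (s + l) * alternating_sum D L (\<lambda>x. of_int x gchoose (s + l)) =
      (\<Sum>q\<le>N. (- 1) ^ q * of_nat (elementary_symmetric N q) * ?p (s + l - q))"
    unfolding N(1) by (rule exp)
  \<comment> \<open>For \<open>q > l\<close> the exponent \<open>s + l - q\<close> is below
    \<open>s\<close>.\<close>
  also have "\<dots> = (\<Sum>q\<le>l. (- 1) ^ q * of_nat (elementary_symmetric N q) * ?p (s + l - q))"
    using N by (intro sum.mono_neutral_right) (auto intro!: zero)
  also have "\<dots> = (\<Sum>\<rho>\<le>l. (- 1) ^ (l - \<rho>) * of_nat (elementary_symmetric N (l - \<rho>)) * ?p (s + \<rho>))"
    by (rule sum.reindex_bij_witness[of _ "\<lambda>\<rho>. l - \<rho>" "\<lambda>q. l - q"]) auto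
  finally show "fact (s + l) * alternating_sum D L (\<lambda>x. of_int x gchoose (s + l)) =
      (\<Sum>\<rho>\<le>l. (- 1) ^ (l - \<rho>) * of_nat (elementary_symmetric (s + l - 1) (l - \<rho>)) * ?p (s + \<rho>))"
    by (simp add: N_def)
qed

text \<open>The degrees \<open>i\<close> and \<open>2 * k - i\<close> have equal parity, so dual
  shifts carry the same sign; the middle module contains both members of its pairs.\<close>

lemma alternating_sum_symmetric_shifts:
  assumes k: "k \<ge> 1"
  shows "alternating_sum (symmetric_shifts k c r a) (2 * k) g =
    g 0 + g c + (\<Sum>i=1..k. \<Sum>j=1..r i. (- 1) ^ i * (g (a i j) + g (c - a i j)))"
proof -
  let ?D = "symmetric_shifts k c r a"
  define lo where "lo = (\<lambda>i. \<Sum>j=1..r i. g (a i j))"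
  define up where "up = (\<lambda>i. \<Sum>j=1..r i. g (c - a i j))"
  define T where "T = (\<lambda>i. (\<Sum>j<length (?D i). g (?D i ! j)))"
  have T: "T i = sum_list (map g (?D i))" for i
    by (simp add: T_def sum_list_sum_nth atLeast0LessThan)
  have sl: "sum_list (map f [Suc 0..<Suc n]) = sum f {Suc 0..n}" for f :: "nat \<Rightarrow> rat" and n
    by (simp add: interv_sum_list_conv_sum_set_nat atLeastLessThanSuc_atLeastAtMost del: upt_Suc)
  have T0: "T 0 = g 0" and T2k: "T (2 * k) = g c"
    using k by (simp_all add: T symmetric_shifts_def)
  have Tk: "T k = lo k + up k"
    using k by (simp add: T symmetric_shifts_def lo_def up_def o_def sl del: upt_Suc)
  have Tlo: "T i = lo i" if "i \<in> {1..<k}" for i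
    using that by (simp add: T symmetric_shifts_def lo_def o_def sl del: upt_Suc)
  have Tup: "T (2 * k - i) = up i" if "i \<in> {1..<k}" for i
    using that by (simp add: T symmetric_shifts_def up_def o_def sl del: upt_Suc) auto
  let ?f = "\<lambda>i. (- 1) ^ i * T i"
  have disj: "{Suc 0..<k} \<inter> {k<..<2 * k} = {}" by auto
  have "{..2 * k} = insert 0 (insert k (insert (2 * k) ({1..<k} \<union> {k<..<2 * k})))"
    using k by auto
  then have "(\<Sum>i\<le>2 * k. ?f i) = ?f 0 + (\<Sum>i\<in>{1..<k}. ?f i) + ?f k + (\<Sum>i\<in>{k<..<2 * k}. ?f i) + ?f (2 * k)"
    using k by (simp add: sum.union_disjoint[OF _ _ disj] add.commute add.left_commute)
  also have "(\<Sum>i\<in>{k<..<2 * k}. ?f i) = (\<Sum>i\<in>{1..<k}. ?f (2 * k - i))"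
    by (rule sum.reindex_bij_witness[of _ "\<lambda>i. 2 * k - i" "\<lambda>i. 2 * k - i"]) auto
  also have "\<dots> = (\<Sum>i\<in>{1..<k}. (- 1) ^ i * up i)"
  proof (rule sum.cong[OF refl])
    fix i assume i: "i \<in> {1..<k}"
    then have "even (2 * k - i) \<longleftrightarrow> even i" by simp
    then have "(- 1 :: rat) ^ (2 * k - i) = (- 1) ^ i"
      by (simp add: minus_one_power_iff)
    then show "?f (2 * k - i) = (- 1) ^ i * up i" using Tup[OF i] by simp
  qed
  also have "(\<Sum>i\<in>{1..<k}. ?f i) = (\<Sum>i\<in>{1..<k}. (- 1) ^ i * lo i)"
    by (rule sum.cong[OF refl]) (simp add: Tlo)
  finally have "(\<Sum>i\<le>2 * k. ?f i) = g 0 + g c +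
      ((\<Sum>i\<in>{1..<k}. (- 1) ^ i * (lo i + up i)) + (- 1) ^ k * (lo k + up k))"
    by (simp add: T0 T2k Tk sum.distrib distrib_left)
  also have "(\<Sum>i\<in>{1..<k}. (- 1) ^ i * (lo i + up i)) + (- 1) ^ k * (lo k + up k) =
      (\<Sum>i=1..k. (- 1) ^ i * (lo i + up i))"
    using k by (simp add: sum.last_plus)
  finally show ?thesis
    by (simp add: alternating_sum_def T_def lo_def up_def sum.distrib sum_distrib_left distrib_left)
qed

text \<open>The case \<open>t = 0\<close> is separate because of the truncated subtraction \<open>t - 1\<close>.\<close>

definition waring_coeff :: "nat \<Rightarrow> nat \<Rightarrow> nat"
  where "waring_coeff m t = (if t = 0 then 1 else if 2 * t \<le> m then ((m - t) choose t) + ((m - t - 1) choose (t - 1)) else 0)"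

text \<open>Pascal's rule for both binomials. It fails for \<open>m = 0\<close> and
  \<open>t = 0\<close>: there \<open>waring_coeff 0 0\<close> is 1, although the power sum of
  exponent 0 is 2.\<close>

lemma waring_coeff_rec:
  assumes "m \<ge> 1"
  shows "waring_coeff (Suc (Suc m)) (Suc t) = waring_coeff (Suc m) (Suc t) + waring_coeff m t"
proof -
  consider "m < 2 * t" | "m = 2 * t" | "2 * t < m" by linarith
  then show ?thesis
  proof cases
    case 3
    \<comment> \<open>This substitution removes the truncated subtractions.\<close>
    then obtain e where e: "m = t + Suc e" "t \<le> e"
      by (intro that[of "m - t - 1"]) auto
    have eqs: "Suc (Suc m) - Suc t = Suc (Suc e)" "Suc m - Suc t = Suc e" "m - t = Suc e"
      by (simp_all add: e(1))
    show ?thesis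
    proof (cases t)
      case 0
      then show ?thesis by (simp add: waring_coeff_def e(1))
    next
      case (Suc u)
      then have "waring_coeff (Suc (Suc m)) (Suc t) = (Suc (Suc e) choose Suc t) + (Suc e choose t)"
        "waring_coeff (Suc m) (Suc t) = (Suc e choose Suc t) + (e choose t)"
        "waring_coeff m t = (Suc e choose t) + (e choose u)"
        using 3 unfolding waring_coeff_def eqs by simp_all
      then show ?thesis by (simp add: Suc)
    qed
  qed (use assms in \<open>auto simp: waring_coeff_def\<close>)
qed

text \<open>Both sides satisfy Newton's recurrence: the next value is \<open>x + y\<close> times the
  last minus \<open>x * y\<close> times the one before.\<close>

lemma waring_formula:
  fixes x y :: "'a::comm_ring_1"
  assumes "m \<ge> 1"
  shows "x ^ m + y ^ m = (\<Sum>t\<le>m div 2. (- 1) ^ t * of_nat (waring_coeff m t) * (x + y) ^ (m - 2 * t) * (x * y) ^ t)"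
proof -
  define F where "F = (\<lambda>m t. (- 1) ^ t * of_nat (waring_coeff m t) * (x + y) ^ (m - 2 * t) * (x * y) ^ t)"
  \<comment> \<open>Summing to \<open>m\<close> instead of \<open>m div 2\<close> adds only zeros
    and avoids a parity split.\<close>
  define S where "S = (\<lambda>m. \<Sum>t\<le>m. F m t)"
  have S: "x ^ Suc m + y ^ Suc m = S (Suc m)" for m
  proof (induction m rule: less_induct)
    case (less m)
    consider "m = 0" | "m = 1" | n where "m = Suc (Suc n)"
      by (metis One_nat_def not0_implies_Suc)
    then show ?case
    proof cases
      case 3
      have step: "F (Suc m) (Suc t) = (x + y) * F m (Suc t) - x * y * F (Suc n) t" for t
      proof -
        have w: "waring_coeff (Suc m) (Suc t) = waring_coeff m (Suc t) + waring_coeff (Suc n) t"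
          unfolding 3 by (rule waring_coeff_rec) simp
        show ?thesis
        proof (cases "2 * Suc t \<le> m")
          case True
          then have "Suc m - 2 * Suc t = Suc (m - 2 * Suc t)" "Suc n - 2 * t = Suc (m - 2 * Suc t)"
            using 3 by simp_all
          then show ?thesis
            unfolding F_def w by (simp add: algebra_simps)
        next
          case False
          \<comment> \<open>Here the exponent \<open>m - 2 * Suc t\<close> is truncated, but its
            coefficient vanishes.\<close>
          then have "waring_coeff m (Suc t) = 0" by (simp add: waring_coeff_def)
          moreover have "Suc m - 2 * Suc t = Suc n - 2 * t" using 3 by simp
          ultimately show ?thesis
            unfolding F_def w by (simp add: algebra_simps)
        qed
      qed
      have F0: "F (Suc m) 0 = (x + y) * F m 0"
        by (simp add: F_def waring_coeff_def)
      have big: "F m t = 0" if "m < t" for m t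
        using that by (simp add: F_def waring_coeff_def)
      have "S (Suc m) = F (Suc m) 0 + (\<Sum>t\<le>m. F (Suc m) (Suc t))"
        unfolding S_def by (rule sum.atMost_Suc_shift)
      also have "\<dots> = (x + y) * (F m 0 + (\<Sum>t\<le>m. F m (Suc t))) - x * y * (\<Sum>t\<le>m. F (Suc n) t)"
        by (simp add: step F0 sum_subtractf sum_distrib_left distrib_left)
      also have "F m 0 + (\<Sum>t\<le>m. F m (Suc t)) = S m"
        unfolding S_def sum.atMost_Suc_shift[symmetric] using big[of m "Suc m"] by simp
      also have "(\<Sum>t\<le>m. F (Suc n) t) = S (Suc n)"
        unfolding S_def 3 using big[of "Suc n" "Suc (Suc n)"] by simp
      also have "(x + y) * S m - x * y * S (Suc n) =
          (x + y) * (x ^ m + y ^ m) - x * y * (x ^ Suc n + y ^ Suc n)"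
        using less.IH[of "Suc n"] less.IH[of n] 3 by simp
      also have "\<dots> = x ^ Suc m + y ^ Suc m"
        by (simp add: 3 algebra_simps)
      finally show ?thesis by simp
    qed (simp_all add: S_def F_def waring_coeff_def algebra_simps power2_eq_square numeral_2_eq_2)
  qed
  have "x ^ m + y ^ m = S m"
    using S[of "m - 1"] assms by simp
  also have "\<dots> = (\<Sum>t\<le>m div 2. F m t)"
    unfolding S_def by (rule sum.mono_neutral_right) (auto simp: F_def waring_coeff_def)
  finally show ?thesis by (simp add: F_def)
qed

text \<open>For \<open>m \<ge> 1\<close> the end shifts contribute \<open>c ^ m\<close>, the shape
  of the term \<open>t = 0\<close> of Waring's formula, and \<open>p 0 = 0\<close> makes the two
  cancel. Then \<open>p (2 * t) = 0\<close> kills \<open>A t\<close> successively for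
  \<open>0 < t < k\<close>, and the sum starts at \<open>k\<close>.\<close>

lemma symmetric_power_sums:
  fixes k :: nat and c :: int and r :: "nat \<Rightarrow> nat" and a :: "nat \<Rightarrow> nat \<Rightarrow> int"
  defines "p \<equiv> \<lambda>m. alternating_sum (symmetric_shifts k c r a) (2 * k) (\<lambda>x. of_int x ^ m)"
    and "A \<equiv> \<lambda>t. \<Sum>i=1..k. \<Sum>j=1..r i. (- 1) ^ i * of_int (a i j) ^ t * of_int (c - a i j) ^ t :: rat"
  assumes k: "k \<ge> 1" and vanish: "\<And>m. m < 2 * k \<Longrightarrow> p m = 0"
  shows "p (2 * k + \<rho>) = (\<Sum>t=0..\<rho> div 2. (- 1) ^ (k + t) *
    of_nat (((k + \<rho> - t) choose (k + t)) + ((k + \<rho> - t - 1) choose (k + t - 1))) *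
    of_int c ^ (\<rho> - 2 * t) * A (k + t))"
proof -
  note shifts = alternating_sum_symmetric_shifts[OF k]
  have A0: "1 + A 0 = 0"
  proof -
    \<comment> \<open>Both end shifts count 1, and so do both members of each pair.\<close>
    have "p 0 = 2 * (1 + A 0)"
      unfolding p_def A_def shifts by (simp add: sum_distrib_left ac_simps)
    with vanish[of 0] k show ?thesis by simp
  qed
  define G where "G = (\<lambda>m t. (- 1) ^ t * of_nat (waring_coeff m t) * of_int c ^ (m - 2 * t) * A t)"
  have p: "p m = (\<Sum>t=1..m div 2. G m t)" if m: "m \<ge> 1" for m
  proof -
    have "(\<Sum>i=1..k. \<Sum>j=1..r i. (- 1) ^ i * (of_int (a i j) ^ m + of_int (c - a i j) ^ m) :: rat) =
        (\<Sum>i=1..k. \<Sum>j=1..r i. \<Sum>t\<le>m div 2. (- 1) ^ t * of_nat (waring_coeff m t) * of_int c ^ (m - 2 * t) *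
          ((- 1) ^ i * of_int (a i j) ^ t * of_int (c - a i j) ^ t))"
      unfolding waring_formula[OF m] sum_distrib_left
      by (intro sum.cong refl) (simp add: power_mult_distrib)
    also have "\<dots> = (\<Sum>t\<le>m div 2. G m t)"
      unfolding G_def A_def sum_distrib_left
      by (subst (2) sum.swap, subst sum.swap) simp
    also have "\<dots> = G m 0 + (\<Sum>t=1..m div 2. G m t)"
      by (simp add: sum.atLeast_Suc_atMost atMost_atLeast0)
    finally have "p m = of_int c ^ m * (1 + A 0) + (\<Sum>t=1..m div 2. G m t)"
      using m unfolding p_def shifts by (simp add: G_def waring_coeff_def distrib_left)
    then show ?thesis by (simp add: A0)
  qed
  have A: "A t = 0" if "1 \<le> t" "t < k" for t
    using that
  proof (induction t rule: less_induct)
    case (less t)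
    have "0 = p (2 * t)" using vanish less.prems by simp
    also have "\<dots> = (\<Sum>u=1..t. G (2 * t) u)" using p[of "2 * t"] less.prems by simp
    also have "\<dots> = (\<Sum>u\<in>{t}. G (2 * t) u)"
      using less by (intro sum.mono_neutral_right) (auto simp: G_def)
    \<comment> \<open>At the top index the coefficient is
      \<open>(t choose t) + ((t - 1) choose (t - 1)) = 2\<close>, so it can be cancelled.\<close>
    also have "\<dots> = (- 1) ^ t * 2 * A t"
      using less.prems by (simp add: G_def waring_coeff_def)
    finally show ?case by simp
  qed
  have "p (2 * k + \<rho>) = (\<Sum>t=1..(2 * k + \<rho>) div 2. G (2 * k + \<rho>) t)"
    using k by (intro p) simp
  also have "\<dots> = (\<Sum>t=k..k + \<rho> div 2. G (2 * k + \<rho>) t)"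
    using k A by (intro sum.mono_neutral_right) (auto simp: G_def)
  also have "\<dots> = (\<Sum>t=0..\<rho> div 2. G (2 * k + \<rho>) (k + t))"
    by (rule sum.reindex_bij_witness[of _ "\<lambda>t. k + t" "\<lambda>t. t - k"]) auto
  also have "\<dots> = (\<Sum>t=0..\<rho> div 2. (- 1) ^ (k + t) *
    of_nat (((k + \<rho> - t) choose (k + t)) + ((k + \<rho> - t - 1) choose (k + t - 1))) *
    of_int c ^ (\<rho> - 2 * t) * A (k + t))"
  proof (rule sum.cong[OF refl])
    fix t assume "t \<in> {0..\<rho> div 2}"
    then have t: "2 * t \<le> \<rho>" by simp
    have "2 * k + \<rho> - (k + t) = k + \<rho> - t" "2 * k + \<rho> - 2 * (k + t) = \<rho> - 2 * t" by simp_all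
    then show "G (2 * k + \<rho>) (k + t) = (- 1) ^ (k + t) *
        of_nat (((k + \<rho> - t) choose (k + t)) + ((k + \<rho> - t - 1) choose (k + t - 1))) *
        of_int c ^ (\<rho> - 2 * t) * A (k + t)"
      unfolding G_def waring_coeff_def using t k by simp
  qed
  finally show ?thesis .
qed

section \<open>Hilbert coefficients as alternating sums of binomials\<close>

lemma pcompose_power: "pcompose (p ^ n) q = pcompose p q ^ n" for p :: "'a::comm_ring_1 poly"
  by (induction n) (simp_all add: pcompose_mult pcompose_1)

text \<open>Nonnegative shifts survive \<open>nat\<close>, and their generalized binomials are the
  coefficients of powers of \<open>[:1, 1:]\<close>.\<close>

lemma alternating_sum_gchoose:
  assumes "\<And>i j. i \<le> L \<Longrightarrow> j < length (D i) \<Longrightarrow> 0 \<le> D i ! j"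
  shows "alternating_sum D L (\<lambda>x. of_int x gchoose m) =
    coeff (pcompose (\<Sum>i\<le>L. (- 1) ^ i * (\<Sum>j<length (D i). monom 1 (nat (D i ! j)))) [:1, 1:]) m"
proof -
  have sign: "coeff ((- 1) ^ i * q) m = (- 1) ^ i * coeff q m" for i and q :: "rat poly"
    by (cases "even i") auto
  have gch: "(of_int (D i ! j) gchoose m :: rat) = of_nat (nat (D i ! j) choose m)"
    if "i \<le> L" "j < length (D i)" for i j
    using assms[OF that] by (simp add: binomial_gbinomial)
  have neg1: "pcompose (- 1) q = (- 1 :: rat poly)" for q
    by (simp add: pcompose_uminus pcompose_1)
  show ?thesis
    by (simp add: pcompose_sum pcompose_mult pcompose_power neg1 coeff_sum sign
        coeff_pcompose_monom_shift alternating_sum_def gch)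
qed

text \<open>\<open>1 - fps_X\<close> is a unit, so the quotient equation can be multiplied out;
  injectivity of \<open>fps_of_poly\<close> gives the uniqueness behind \<open>THE\<close>.\<close>

lemma hilbert_numerator_eqI:
  assumes "hilbert_series I * (1 - fps_X) ^ d = fps_of_poly Q"
  shows "hilbert_numerator I d = Q"
proof -
  let ?u = "(1 - fps_X :: rat fps) ^ d"
  have u0: "fps_nth ?u 0 \<noteq> 0" by (simp add: fps_nth_power_0)
  have *: "hilbert_series I = fps_of_poly Q' / ?u \<longleftrightarrow> hilbert_series I * ?u = fps_of_poly Q'" for Q'
    using u0 by (auto simp: fps_divide_unit mult.assoc inverse_mult_eq_1 inverse_mult_eq_1'
        dest: arg_cong[of _ _ "\<lambda>f. f * inverse ?u"])
  show ?thesis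
    unfolding hilbert_numerator_def * assms fps_of_poly_eq_iff by simp
qed

text \<open>With \<open>P = [:1, - 1:] ^ s * Q\<close>, the Taylor coefficients of \<open>P\<close>
  at 1 are those of \<open>Q\<close> moved up by \<open>s\<close> places, and \<open>Q\<close> is
  the Hilbert numerator.\<close>

lemma hilbert_coefficient_eq_alternating_sum:
  fixes I :: "('n::finite, 'k::field) mpoly set"
  assumes I: "ideal I mpoly_ring" "1 \<notin> I" and gr: "grade mpoly_ring I = enat s"
    and s: "s \<ge> 1" "even s"
    and res: "minimal_graded_free_resolution I D \<phi>" and fin: "\<And>i. i > L \<Longrightarrow> D i = []"
  shows "hilbert_coefficient I (CARD('n) - s) l = alternating_sum D L (\<lambda>x. of_int x gchoose (s + l))"
    and "m < s \<Longrightarrow> alternating_sum D L (\<lambda>x. of_int x gchoose m) = 0"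
proof -
  define P :: "rat poly" where "P = (\<Sum>i\<le>L. (- 1) ^ i * (\<Sum>j<length (D i). monom 1 (nat (D i ! j))))"
  have HP: "hilbert_series I * (1 - fps_X) ^ CARD('n) = fps_of_poly P"
    unfolding P_def by (rule hilbert_series_times[OF res I fin])
  have le: "s \<le> CARD('n)"
    by (rule grade_le_card[OF I gr s(1)])
  \<comment> \<open>The series of partial sums carries one more factor \<open>1 - fps_X\<close> in
    the denominator; its coefficients will be the affine Hilbert function.\<close>
  define H where "H = Abs_fps (\<lambda>m. \<Sum>i\<le>m. fps_nth (hilbert_series I) i)"
  have H: "H * (1 - fps_X) = hilbert_series I"
  proof (rule fps_ext)
    show "fps_nth (H * (1 - fps_X)) m = fps_nth (hilbert_series I) m" for m
      by (cases m) (simp_all add: H_def right_diff_distrib)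
  qed
  obtain C where C: "\<And>m. (m + 1) ^ s * affine_hilbert I m \<le> C * (m + 1) ^ CARD('n)"
    using affine_hilbert_growth[OF I(1) gr s(1)] by blast
  have "affine_hilbert I m = (\<Sum>i\<le>m. hilbert_function I i)" for m
    by (rule affine_hilbert_eq_sum[OF I]) (rule homogeneous_part_resolved_ideal[OF res])
  then have Hm: "fps_nth H m = of_nat (affine_hilbert I m)" for m
    by (simp add: H_def hilbert_series_def)
  have "[:1, - 1:] ^ s dvd P"
  proof (rule one_minus_power_dvd_if_growth[OF _ le])
    show "H * (1 - fps_X) ^ Suc CARD('n) = fps_of_poly P"
      using HP by (simp add: H mult.assoc[symmetric])
    show "of_nat (m + 1) ^ s * \<bar>fps_nth H m\<bar> \<le> of_nat C * of_nat (m + 1) ^ CARD('n)" for m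
    proof -
      have "of_nat ((m + 1) ^ s * affine_hilbert I m) \<le> (of_nat (C * (m + 1) ^ CARD('n)) :: rat)"
        by (simp only: of_nat_le_iff C)
      then show ?thesis by (simp only: Hm abs_of_nat of_nat_mult of_nat_power)
    qed
  qed
  then obtain Q where Q: "P = [:1, - 1:] ^ s * Q" by blast
  have "(1 - fps_X) ^ s * (hilbert_series I * (1 - fps_X) ^ (CARD('n) - s)) = (1 - fps_X) ^ s * fps_of_poly Q"
  proof -
    have "CARD('n) = s + (CARD('n) - s)" using le by simp
    then have "(1 - fps_X) ^ s * (hilbert_series I * (1 - fps_X) ^ (CARD('n) - s)) =
        hilbert_series I * (1 - fps_X) ^ CARD('n)"
      by (metis mult.left_commute power_add)
    also have "\<dots> = (1 - fps_X) ^ s * fps_of_poly Q"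
      unfolding HP Q fps_of_poly_mult fps_of_poly_power by (simp add: fps_of_poly_pCons)
    finally show ?thesis .
  qed
  moreover have "(1 - fps_X :: rat fps) ^ s \<noteq> 0"
  proof -
    have "fps_nth (1 - fps_X :: rat fps) 0 \<noteq> 0" by simp
    then show ?thesis by (metis fps_zero_nth power_eq_0_iff)
  qed
  ultimately have "hilbert_series I * (1 - fps_X) ^ (CARD('n) - s) = fps_of_poly Q"
    using mult_left_cancel by blast
  then have num: "hilbert_numerator I (CARD('n) - s) = Q"
    by (rule hilbert_numerator_eqI)
  \<comment> \<open>The sign disappears in the power because \<open>s\<close> is even.\<close>
  have "pcompose [:1, - 1:] [:1, 1 :: rat:] = - monom 1 1"
    by (simp add: pcompose_pCons monom_altdef)
  then have "pcompose P [:1, 1:] = monom 1 s * pcompose Q [:1, 1:]"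
    using s(2) by (simp add: Q pcompose_mult pcompose_power monom_power)
  then have coeff: "alternating_sum D L (\<lambda>x. of_int x gchoose m) =
      (if m < s then 0 else coeff (pcompose Q [:1, 1:]) (m - s))" for m
    using alternating_sum_gchoose[of L D m] shifts_nonneg[OF res] by (simp add: P_def coeff_monom_mult)
  then show "m < s \<Longrightarrow> alternating_sum D L (\<lambda>x. of_int x gchoose m) = 0" by simp
  show "hilbert_coefficient I (CARD('n) - s) l = alternating_sum D L (\<lambda>x. of_int x gchoose (s + l))"
    by (simp add: hilbert_coefficient_def num poly_higher_pderiv_one coeff)
qed

theorem theorem3p7:
  fixes I :: "('n::finite, 'k::field) mpoly set"
    and k s l :: nat
    and c :: int
    and r :: "nat \<Rightarrow> nat"
    and a :: "nat \<Rightarrow> nat \<Rightarrow> int"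
    and \<phi> :: "nat \<Rightarrow> (nat \<Rightarrow> ('n, 'k) mpoly) \<Rightarrow> (nat \<Rightarrow> ('n, 'k) mpoly)"
  assumes "k \<ge> 1"
    and "s = 2 * k"
    and "ideal I mpoly_ring"
    and "I \<subseteq> irrelevant_ideal"
    and "homogeneous_ideal I"
    and "gorenstein_ring (mpoly_ring Quot I)"
    and "grade mpoly_ring I = enat s"
    and "minimal_graded_free_resolution I (symmetric_shifts k c r a) \<phi>"
  shows "(-1) ^ k * fact (s + l) * hilbert_coefficient I (CARD('n) - s) l =
    (\<Sum>\<rho>=0..l. \<Sum>t=0..\<rho> div 2.
       (-1) ^ (l - \<rho> + t) * of_nat (elementary_symmetric (s + l - 1) (l - \<rho>)) *
       of_nat (((k + \<rho> - t) choose (k + t)) + ((k + \<rho> - t - 1) choose (k + t - 1))) *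
       of_int c ^ (\<rho> - 2 * t) *
       (\<Sum>i=1..k. \<Sum>j=1..r i.
          (-1) ^ i * of_int (a i j) ^ (k + t) * of_int (c - a i j) ^ (k + t)))"
proof -
  let ?D = "symmetric_shifts k c r a"
  let ?p = "\<lambda>m. alternating_sum ?D (2 * k) (\<lambda>x. of_int x ^ m)"
  let ?A = "\<lambda>t. \<Sum>i=1..k. \<Sum>j=1..r i. (- 1) ^ i * of_int (a i j) ^ t * of_int (c - a i j) ^ t :: rat"
  have I: "1 \<notin> I"
    using assms(4) one_notin_irrelevant_ideal by blast
  have s: "s \<ge> 1" "even s" using assms(1,2) by auto
  have fin: "?D i = []" if "i > 2 * k" for i
    using that by (simp add: symmetric_shifts_def)
  have coeff: "hilbert_coefficient I (CARD('n) - s) l = alternating_sum ?D (2 * k) (\<lambda>x. of_int x gchoose (s + l))"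
    and vanish: "\<And>m. m < s \<Longrightarrow> alternating_sum ?D (2 * k) (\<lambda>x. of_int x gchoose m) = 0"
    using hilbert_coefficient_eq_alternating_sum[OF assms(3) I assms(7) s assms(8), of "2 * k"] fin by blast+
  have zero: "?p m = 0" if "m < s" for m
    by (rule factorial_moments_imp_power_sums(1)[OF _ that]) (rule vanish)
  have top: "fact (s + l) * alternating_sum ?D (2 * k) (\<lambda>x. of_int x gchoose (s + l)) =
      (\<Sum>\<rho>\<le>l. (- 1) ^ (l - \<rho>) * of_nat (elementary_symmetric (s + l - 1) (l - \<rho>)) * ?p (s + \<rho>))"
    by (rule factorial_moments_imp_power_sums(2)[OF _ s(1)]) (rule vanish)
  have p: "?p (s + \<rho>) = (\<Sum>t=0..\<rho> div 2. (- 1) ^ (k + t) *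
      of_nat (((k + \<rho> - t) choose (k + t)) + ((k + \<rho> - t - 1) choose (k + t - 1))) *
      of_int c ^ (\<rho> - 2 * t) * ?A (k + t))" for \<rho>
    unfolding assms(2) by (rule symmetric_power_sums[OF assms(1)]) (rule zero, simp add: assms(2))
  have "(- 1) ^ k * fact (s + l) * hilbert_coefficient I (CARD('n) - s) l =
      (\<Sum>\<rho>\<le>l. (- 1) ^ k * ((- 1) ^ (l - \<rho>) * of_nat (elementary_symmetric (s + l - 1) (l - \<rho>)) * ?p (s + \<rho>)))"
    unfolding coeff mult.assoc[of "(- 1) ^ k" "fact (s + l)"] top by (rule sum_distrib_left)
  also have "\<dots> = (\<Sum>\<rho>=0..l. \<Sum>t=0..\<rho> div 2.
       (-1) ^ (l - \<rho> + t) * of_nat (elementary_symmetric (s + l - 1) (l - \<rho>)) *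
       of_nat (((k + \<rho> - t) choose (k + t)) + ((k + \<rho> - t - 1) choose (k + t - 1))) *
       of_int c ^ (\<rho> - 2 * t) * ?A (k + t))"
    unfolding atMost_atLeast0 p sum_distrib_left[of _ _ "{0.._ div 2}"]
  proof (intro sum.cong refl)
    fix \<rho> t
    \<comment> \<open>The factor \<open>(- 1) ^ k\<close> of the statement cancels against Waring's
      sign at index \<open>k + t\<close>.\<close>
    have "(- 1 :: rat) ^ k * (- 1) ^ (k + t) = (- 1) ^ t"
      by (simp add: power_add flip: power_mult_distrib mult.assoc)
    then have "(- 1) ^ k * (x * e * ((- 1) ^ (k + t) * b * y * A)) = x * (- 1) ^ t * e * b * y * A"
      for x e b y A :: rat
      by (metis (no_types, opaque_lifting) mult.assoc mult.left_commute)
    then show "(- 1) ^ k * ((- 1) ^ (l - \<rho>) * of_nat (elementary_symmetric (s + l - 1) (l - \<rho>)) *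
        ((- 1) ^ (k + t) * of_nat (((k + \<rho> - t) choose (k + t)) + ((k + \<rho> - t - 1) choose (k + t - 1))) *
          of_int c ^ (\<rho> - 2 * t) * ?A (k + t))) =
        (-1) ^ (l - \<rho> + t) * of_nat (elementary_symmetric (s + l - 1) (l - \<rho>)) *
        of_nat (((k + \<rho> - t) choose (k + t)) + ((k + \<rho> - t - 1) choose (k + t - 1))) *
        of_int c ^ (\<rho> - 2 * t) * ?A (k + t)"
      unfolding power_add[of "- 1" "l - \<rho>"] .
  qed
  finally show ?thesis .
qed

end
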